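(* Let $\Omega\subseteq\mathbb{C}$ be an arbitrary open set, let $\zeta_0\in\Omega$, and let $\mathcal{F}\subseteq\mathbb{N}\times\mathbb{N}$ contain a sequence $(\tilde p_n,\tilde q_n)\in\mathcal{F}$, $n\in\mathbb{N}$, such that $\tilde p_n\to+\infty$ and $\tilde q_n\to+\infty$ as $n\to+\infty$. Then there exists $f\in H(\Omega)$ with the following property: there exists a sequence $(p_n,q_n)_{n\in\mathbb{N}}$ in $\mathcal{F}$ such that $f\in\mathcal{D}_{p_n,q_n}(\zeta_0)$ for all $n\in\mathbb{N}$, and for every compact set $K\subseteq\Omega$ it holds that $\sup_{z\in K}\big|[p_n/q_n]_{f,\zeta_0}(z)-f(z)\big|\to 0$ as $n\to+\infty$. In addition, the set of all $f\in H(\Omega)$ with this property is a $G_\delta$ and dense subset of $H(\Omega)$.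
   Context: $H(\Omega)$ is the space of holomorphic functions on $\Omega$ with the topology of uniform convergence on compact subsets of $\Omega$. Padé approximants. Degrees $p,q$ range over $\mathbb{N}=\{0,1,2,\dots\}$. Let $f=\sum_{v\ge 0}a_v(z-\zeta)^v$ be a power series centered at $\zeta\in\mathbb{C}$ (for $f$ holomorphic near $\zeta$, its Taylor series at $\zeta$). A Padé approximant $[p/q]_{f,\zeta}$ is a rational function of the form $P/Q$, $P(z)=\sum_{v=0}^p n_v(z-\zeta)^v$, $Q(z)=\sum_{v=0}^q d_v(z-\zeta)^v$ with $d_0=1$, whose Taylor coefficients $b_v$ at $\zeta$ satisfy $b_v=a_v$ for $v=0,\dots,p+q$. We write $f\in\mathcal{D}_{p,q}(\zeta)$ if the Hankel determinant $\det\big(a_{p-q+i+j-1}\big)_{i,j=1}^q$ is nonzero, with $a_i=0$ for $i<0$ (for $q=0$ the condition is always satisfied). In that case $[p/q]_{f,\zeta}$ exists and is unique (for $q=0$ it is the Taylor partial sum $\sum_{v=0}^p a_v(z-\zeta)^v$). The value of a rational function at a pole is taken to be $\infty$, so a finite supremum over $K$ means that there are no poles in $K$. *)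

theory Defs
  imports
    "HOL-Complex_Analysis.Complex_Analysis"
    "HOL-Computational_Algebra.Computational_Algebra"
    "HOL-Computational_Algebra.Field_as_Ring"
    "Jordan_Normal_Form.Determinant"
begin

text \<open>
  Holomorphic functions on \<open>\<Omega>\<close> are represented by the elements of \<^term>\<open>extensional \<Omega>\<close>, so that
  two functions that agree on \<open>\<Omega>\<close> are equal.
\<close>

definition hol_space :: "complex set \<Rightarrow> (complex \<Rightarrow> complex) set" where
  "hol_space \<Omega> = {f \<in> extensional \<Omega>. f holomorphic_on \<Omega>}"

text \<open>
  The topology of uniform convergence on compact subsets of \<open>\<Omega>\<close>: the sets
  \<open>{g. \<forall>z\<in>K. dist (f z) (g z) < e}\<close>, for compact \<open>K \<subseteq> \<Omega>\<close> and \<open>e > 0\<close>, form a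
  neighbourhood basis of \<open>f\<close>.
\<close>

definition hol_topology :: "complex set \<Rightarrow> (complex \<Rightarrow> complex) topology" where
  "hol_topology \<Omega> = topology (\<lambda>U. U \<subseteq> hol_space \<Omega> \<and>
     (\<forall>f\<in>U. \<exists>K e. compact K \<and> K \<subseteq> \<Omega> \<and> e > 0 \<and>
        {g \<in> hol_space \<Omega>. \<forall>z\<in>K. dist (f z) (g z) < e} \<subseteq> U))"

lemma openin_hol_topology:
  "openin (hol_topology \<Omega>) U \<longleftrightarrow> U \<subseteq> hol_space \<Omega> \<and>
     (\<forall>f\<in>U. \<exists>K e. compact K \<and> K \<subseteq> \<Omega> \<and> e > 0 \<and>
        {g \<in> hol_space \<Omega>. \<forall>z\<in>K. dist (f z) (g z) < e} \<subseteq> U)"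
proof -
  define B where "B = (\<lambda>K e f. {g \<in> hol_space \<Omega>. \<forall>z\<in>K. dist (f z) (g z) < (e::real)})"
  define L where "L = (\<lambda>U. U \<subseteq> hol_space \<Omega> \<and>
     (\<forall>f\<in>U. \<exists>K e. compact K \<and> K \<subseteq> \<Omega> \<and> e > 0 \<and> B K e f \<subseteq> U))"
  have "L (S \<inter> T)" if "L S" "L T" for S T
  proof -
    have "\<exists>K e. compact K \<and> K \<subseteq> \<Omega> \<and> e > 0 \<and> B K e f \<subseteq> S \<inter> T" if "f \<in> S \<inter> T" for f
    proof -
      from \<open>L S\<close> that obtain K e where 1: "compact K" "K \<subseteq> \<Omega>" "e > 0" "B K e f \<subseteq> S"
        unfolding L_def by blast
      from \<open>L T\<close> that obtain K' e' where 2: "compact K'" "K' \<subseteq> \<Omega>" "e' > 0" "B K' e' f \<subseteq> T"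
        unfolding L_def by blast
      have "B (K \<union> K') (min e e') f \<subseteq> B K e f \<inter> B K' e' f"
        by (auto simp: B_def)
      with 1 2 show ?thesis
        by (intro exI[of _ "K \<union> K'"] exI[of _ "min e e'"]) auto
    qed
    with that show ?thesis unfolding L_def by blast
  qed
  moreover have "L (\<Union>\<K>)" if \<K>: "\<forall>U\<in>\<K>. L U" for \<K>
  proof -
    have "\<exists>K e. compact K \<and> K \<subseteq> \<Omega> \<and> e > 0 \<and> B K e f \<subseteq> \<Union>\<K>" if f: "U \<in> \<K>" "f \<in> U" for f U
    proof -
      have "L U" using \<K> f(1) by simp
      then obtain K e where K: "compact K" "K \<subseteq> \<Omega>" "e > 0" "B K e f \<subseteq> U"
        using f(2) unfolding L_def by blast
      have "B K e f \<subseteq> \<Union>\<K>"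
        using K(4) f(1) by (rule order.trans[OF _ Union_upper])
      with K show ?thesis by (intro exI[of _ K] exI[of _ e]) simp
    qed
    moreover have "\<Union>\<K> \<subseteq> hol_space \<Omega>"
      using \<K> by (intro Union_least) (simp add: L_def)
    ultimately show ?thesis unfolding L_def by (metis Union_iff)
  qed
  ultimately have "istopology L"
    unfolding istopology_def by simp
  hence "openin (topology L) = L"
    by (rule topology_inverse')
  thus ?thesis
    unfolding hol_topology_def L_def B_def by simp
qed

lemma topspace_hol_topology [simp]: "topspace (hol_topology \<Omega>) = hol_space \<Omega>"
proof
  show "topspace (hol_topology \<Omega>) \<subseteq> hol_space \<Omega>"
    using openin_hol_topology[of \<Omega> "topspace (hol_topology \<Omega>)"] by simp
  have "openin (hol_topology \<Omega>) (hol_space \<Omega>)"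
    unfolding openin_hol_topology
    by (auto intro!: exI[of _ "{}"] exI[of _ "1::real"])
  thus "hol_space \<Omega> \<subseteq> topspace (hol_topology \<Omega>)"
    by (rule openin_subset)
qed

text \<open>
  Power series \<open>\<Sum>v. a\<^sub>v (z - \<zeta>)\<^sup>v\<close> and rational functions are written in the local variable
  \<open>w = z - \<zeta>\<close>; the power series is then an element of \<^typ>\<open>complex fps\<close> and the rational function
  an element of \<^typ>\<open>complex poly fract\<close>.
\<close>

definition fps_nth_int :: "complex fps \<Rightarrow> int \<Rightarrow> complex" where
  "fps_nth_int A k = (if k < 0 then 0 else fps_nth A (nat k))"

text \<open>
  The matrix indices run from \<open>0\<close> to \<open>q - 1\<close>, hence the shift of the index of the coefficient.
  For \<open>q = 0\<close> the determinant is \<open>1\<close>.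
\<close>

definition hankel_det :: "complex fps \<Rightarrow> nat \<Rightarrow> nat \<Rightarrow> complex" where
  "hankel_det A p q = Determinant.det (Matrix.mat q q
     (\<lambda>(i, j). fps_nth_int A (int p - int q + int (Suc i) + int (Suc j) - 1)))"

definition is_pade :: "complex fps \<Rightarrow> nat \<Rightarrow> nat \<Rightarrow> complex poly fract \<Rightarrow> bool" where
  "is_pade A p q R \<longleftrightarrow> (\<exists>P Q. degree P \<le> p \<and> degree Q \<le> q \<and> poly.coeff Q 0 = 1 \<and>
     R = Fraction_Field.Fract P Q \<and>
     (\<forall>v\<le>p + q. fps_nth (fps_of_poly P / fps_of_poly Q) v = fps_nth A v))"

lemma is_pade_unique:
  assumes "is_pade A p q R" "is_pade A p q R'"
  shows   "R = R'"
proof -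
  from assms obtain P Q P' Q' where
    PQ: "degree P \<le> p" "degree Q \<le> q" "poly.coeff Q 0 = 1" "R = Fraction_Field.Fract P Q"
        "\<And>v. v \<le> p + q \<Longrightarrow> fps_nth (fps_of_poly P / fps_of_poly Q) v = fps_nth A v" and
    PQ': "degree P' \<le> p" "degree Q' \<le> q" "poly.coeff Q' 0 = 1" "R' = Fraction_Field.Fract P' Q'"
        "\<And>v. v \<le> p + q \<Longrightarrow> fps_nth (fps_of_poly P' / fps_of_poly Q') v = fps_nth A v"
    unfolding is_pade_def by blast
  define G where "G = fps_of_poly P / fps_of_poly Q"
  define G' where "G' = fps_of_poly P' / fps_of_poly Q'"
  have "is_unit (fps_of_poly Q)" "is_unit (fps_of_poly Q')"
    using PQ(3) PQ'(3) by simp_all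
  hence P: "fps_of_poly P = G * fps_of_poly Q" "fps_of_poly P' = G' * fps_of_poly Q'"
    by (simp_all add: G_def G'_def unit_imp_dvd)
  have eq: "fps_of_poly (P * Q' - P' * Q) = (G - G') * (fps_of_poly Q * fps_of_poly Q')"
    by (simp add: fps_of_poly_diff fps_of_poly_mult P algebra_simps)
  have "poly.coeff (P * Q' - P' * Q) v = 0" for v
  proof (cases "v \<le> p + q")
    case True
    have "fps_nth (fps_of_poly (P * Q' - P' * Q)) v = 0"
      unfolding eq fps_mult_nth[of "G - G'"]
      using True PQ(5) PQ'(5) by (intro sum.neutral) (simp add: G_def G'_def)
    thus ?thesis by simp
  next
    case False
    have "degree (P * Q') \<le> p + q" "degree (P' * Q) \<le> p + q"
      using degree_mult_le[of P Q'] degree_mult_le[of P' Q] PQ PQ' by linarith+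
    with False show ?thesis by (simp add: coeff_eq_0)
  qed
  hence "P * Q' = P' * Q"
    by (metis poly_eqI coeff_0 right_minus_eq)
  moreover have "Q \<noteq> 0" "Q' \<noteq> 0" using PQ(3) PQ'(3) by auto
  ultimately show ?thesis
    by (simp add: PQ(4) PQ'(4) eq_fract)
qed

definition pade :: "complex fps \<Rightarrow> nat \<Rightarrow> nat \<Rightarrow> complex poly fract" where
  "pade A p q = (THE R. is_pade A p q R)"

text \<open>
  Value of a rational function on the Riemann sphere, computed from the representation in lowest
  terms, where \<^term>\<open>None\<close> stands for the point at infinity.
\<close>

definition fract_eval :: "complex poly fract \<Rightarrow> complex \<Rightarrow> complex option" where
  "fract_eval R w = (case quot_of_fract R of (P, Q) \<Rightarrow>
     if poly Q w = 0 then None else Some (poly P w / poly Q w))"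

definition ext_dist :: "complex option \<Rightarrow> complex \<Rightarrow> ennreal" where
  "ext_dist u c = (case u of None \<Rightarrow> \<infinity> | Some b \<Rightarrow> ennreal (cmod (b - c)))"

definition pade_class :: "nat \<Rightarrow> nat \<Rightarrow> complex \<Rightarrow> (complex \<Rightarrow> complex) set" where
  "pade_class p q \<zeta> = {f. hankel_det (fps_expansion f \<zeta>) p q \<noteq> 0}"

definition pade_at :: "nat \<Rightarrow> nat \<Rightarrow> (complex \<Rightarrow> complex) \<Rightarrow> complex \<Rightarrow> complex \<Rightarrow> complex option" where
  "pade_at p q f \<zeta> z = fract_eval (pade (fps_expansion f \<zeta>) p q) (z - \<zeta>)"

text \<open>
  The supremum is taken in \<^typ>\<open>ennreal\<close>, so that it is \<open>\<infinity>\<close> if there is a pole in \<open>K\<close>, and \<open>0\<close>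
  if \<open>K\<close> is empty. The sequence of indices does not depend on \<open>K\<close>.
\<close>

definition pade_approximable ::
    "complex set \<Rightarrow> complex \<Rightarrow> (nat \<times> nat) set \<Rightarrow> (complex \<Rightarrow> complex) \<Rightarrow> bool" where
  "pade_approximable \<Omega> \<zeta> F f \<longleftrightarrow> (\<exists>p q :: nat \<Rightarrow> nat.
     (\<forall>n. (p n, q n) \<in> F) \<and>
     (\<forall>n. f \<in> pade_class (p n) (q n) \<zeta>) \<and>
     (\<forall>K. compact K \<and> K \<subseteq> \<Omega> \<longrightarrow>
        (\<lambda>n. SUP z\<in>K. ext_dist (pade_at (p n) (q n) f \<zeta> z) (f z)) \<longlonglongrightarrow> 0))"

end

theory Submission
  imports Defs
begin

text \<open>
  The functions in question form \<open>\<Inter>n. V n\<close>, where \<open>V n\<close> asks for some \<open>(p, q) \<in> F\<close> with nonzero Hankel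
  determinant and error less than \<open>1 / (n + 1)\<close> on the \<open>n\<close>-th set of a compact exhaustion. Each \<open>V n\<close> is open,
  because by Cramer's rule numerator and denominator of the Pade approximant depend continuously on
  the Taylor coefficients. It is dense: by Runge's theorem every \<open>f \<in> H(\<Omega>)\<close> is close to some \<open>A / B\<close>
  with poles off \<open>\<Omega>\<close>, and for \<open>p > deg A\<close>, \<open>q \<ge> deg B\<close> the function \<open>(A + c (z - \<zeta>)\<^sup>p) / B\<close> with small generic
  \<open>c\<close> equals its own \<open>[p/q]\<close> approximant and has nonzero Hankel determinant. Baire's theorem
  concludes.
\<close>

section \<open>Rational approximation\<close>

text \<open>For A / B itself, with p > deg A and q > deg B, the Hankel determinant is zero: w B and
  w A, in the local variable w, give a kernel vector. The small monomial removes this degeneracy by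
  making the numerator degree exactly p. Since deg A and deg B are not known beforehand, p and q
  must be large simultaneously. The rational functions must lie in H(\<Omega>), so their poles avoid
  all of \<Omega> while the approximation takes place on K only; \<open>rational_limit\<close>
  therefore carries two sets. Poles are read off from lowest terms, whereas continuity is available
  for the explicit numerator and denominator. Coprimality of that pair links the two: a finite error
  on K then means that the explicit denominator has no zero on K.\<close>

definition rational_limit :: "complex set \<Rightarrow> complex set \<Rightarrow> (complex \<Rightarrow> complex) \<Rightarrow> bool" where
  "rational_limit \<Omega> K g \<longleftrightarrow> (\<forall>e>0. \<exists>A B. (\<forall>z\<in>\<Omega>. poly B z \<noteq> 0) \<and>
     (\<forall>z\<in>K. cmod (g z - poly A z / poly B z) < e))"

lemma rational_limit_exact:
  assumes "\<And>z. z \<in> \<Omega> \<Longrightarrow> poly B z \<noteq> 0" "\<And>z. z \<in> K \<Longrightarrow> g z = poly A z / poly B z"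
  shows "rational_limit \<Omega> K g"
  unfolding rational_limit_def using assms by (metis cancel_comm_monoid_add_class.diff_cancel norm_zero)

lemma rational_limit_limit:
  assumes "\<And>e. e > 0 \<Longrightarrow> \<exists>h. rational_limit \<Omega> K h \<and> (\<forall>z\<in>K. cmod (g z - h z) < e)"
  shows "rational_limit \<Omega> K g"
  unfolding rational_limit_def
proof (intro allI impI)
  fix e :: real assume "e > 0"
  then obtain h where h: "rational_limit \<Omega> K h" "\<forall>z\<in>K. cmod (g z - h z) < e / 2"
    using assms[of "e / 2"] by auto
  obtain A B where AB: "\<forall>z\<in>\<Omega>. poly B z \<noteq> 0" "\<forall>z\<in>K. cmod (h z - poly A z / poly B z) < e / 2"
    using h(1) half_gt_zero[OF \<open>e > 0\<close>] unfolding rational_limit_def by blast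
  have "cmod (g z - poly A z / poly B z) < e" if "z \<in> K" for z
    using h(2) AB(2) that norm_triangle_lt[of "g z - h z" "h z - poly A z / poly B z" e] by fastforce
  with AB(1) show "\<exists>A B. (\<forall>z\<in>\<Omega>. poly B z \<noteq> 0) \<and> (\<forall>z\<in>K. cmod (g z - poly A z / poly B z) < e)"
    by blast
qed

lemma rational_limit_cong:
  assumes "\<And>z. z \<in> K \<Longrightarrow> f z = g z" "rational_limit \<Omega> K f"
  shows "rational_limit \<Omega> K g"
  using assms unfolding rational_limit_def by simp

lemma rational_limit_add:
  assumes "K \<subseteq> \<Omega>" "rational_limit \<Omega> K f" "rational_limit \<Omega> K g"
  shows "rational_limit \<Omega> K (\<lambda>z. f z + g z)"
  unfolding rational_limit_def
proof (intro allI impI)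
  fix e :: real assume "e > 0"
  then have e2: "e / 2 > 0" by simp
  obtain A B where AB: "\<forall>z\<in>\<Omega>. poly B z \<noteq> 0" "\<forall>z\<in>K. cmod (f z - poly A z / poly B z) < e / 2"
    using assms(2) e2 unfolding rational_limit_def by blast
  obtain C D where CD: "\<forall>z\<in>\<Omega>. poly D z \<noteq> 0" "\<forall>z\<in>K. cmod (g z - poly C z / poly D z) < e / 2"
    using assms(3) e2 unfolding rational_limit_def by blast
  have "cmod (f z + g z - poly (A * D + C * B) z / poly (B * D) z) < e" if "z \<in> K" for z
  proof -
    have "poly (A * D + C * B) z / poly (B * D) z = poly A z / poly B z + poly C z / poly D z"
      using AB(1) CD(1) that assms(1) by (auto simp: add_frac_eq)
    moreover have "cmod ((f z - poly A z / poly B z) + (g z - poly C z / poly D z)) < e"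
      using AB(2) CD(2) that by (intro norm_triangle_lt) fastforce
    ultimately show ?thesis by (simp add: algebra_simps)
  qed
  moreover have "\<forall>z\<in>\<Omega>. poly (B * D) z \<noteq> 0" using AB(1) CD(1) by simp
  ultimately show "\<exists>A B. (\<forall>z\<in>\<Omega>. poly B z \<noteq> 0) \<and> (\<forall>z\<in>K. cmod (f z + g z - poly A z / poly B z) < e)"
    by blast
qed

lemma rational_limit_cmult:
  assumes "rational_limit \<Omega> K f"
  shows "rational_limit \<Omega> K (\<lambda>z. c * f z)"
  unfolding rational_limit_def
proof (intro allI impI)
  fix e :: real assume "e > 0"
  \<comment> \<open>The extra 1 keeps the divisor positive when c = 0.\<close>
  then have e': "e / (cmod c + 1) > 0" by (simp add: add_nonneg_pos)
  then obtain A B where AB: "\<forall>z\<in>\<Omega>. poly B z \<noteq> 0" "\<forall>z\<in>K. cmod (f z - poly A z / poly B z) < e / (cmod c + 1)"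
    using assms unfolding rational_limit_def by blast
  have "cmod (c * f z - poly (Polynomial.smult c A) z / poly B z) < e" if "z \<in> K" for z
  proof -
    have "cmod (c * f z - poly (Polynomial.smult c A) z / poly B z) = cmod c * cmod (f z - poly A z / poly B z)"
      by (simp add: norm_mult[symmetric] algebra_simps)
    also have "\<dots> \<le> cmod c * (e / (cmod c + 1))"
      using AB(2) that by (intro mult_left_mono) fastforce+
    also have "\<dots> < (cmod c + 1) * (e / (cmod c + 1))"
      by (rule mult_strict_right_mono[OF _ e']) simp
    also have "\<dots> = e" using e' by auto
    finally show ?thesis .
  qed
  with AB(1) show "\<exists>A B. (\<forall>z\<in>\<Omega>. poly B z \<noteq> 0) \<and> (\<forall>z\<in>K. cmod (c * f z - poly A z / poly B z) < e)"
    by blast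
qed

lemma rational_limit_diff:
  assumes "K \<subseteq> \<Omega>" "rational_limit \<Omega> K f" "rational_limit \<Omega> K g"
  shows "rational_limit \<Omega> K (\<lambda>z. f z - g z)"
  using rational_limit_add[OF assms(1,2) rational_limit_cmult[OF assms(3), of "-1"]] by simp

lemma rational_limit_sum:
  assumes "K \<subseteq> \<Omega>" "\<And>i. i \<in> I \<Longrightarrow> rational_limit \<Omega> K (f i)"
  shows "rational_limit \<Omega> K (\<lambda>z. \<Sum>i\<in>I. f i z)"
  using assms(2)
proof (induction I rule: infinite_finite_induct)
  case (insert i I)
  then show ?case using rational_limit_add[OF assms(1)] by simp
qed (auto intro: rational_limit_exact[of \<Omega> 1 _ _ 0])

section \<open>Geometric expansions of simple poles\<close>

lemma geometric_remainder:
  fixes u v :: complex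
  assumes "u \<noteq> 0" "u \<noteq> v"
  shows "1 / (u - v) = (\<Sum>k<N. v ^ k / u ^ Suc k) + (v / u) ^ N / (u - v)"
proof (induction N)
  case (Suc N)
  have "1 / (u - v) = 1 / u + v / u / (u - v)"
    using assms by (simp add: field_simps)
  then have "(v / u) ^ N * (1 / (u - v)) = (v / u) ^ N * (1 / u + v / u / (u - v))" by simp
  then have "(v / u) ^ N / (u - v) = v ^ N / u ^ Suc N + (v / u) ^ Suc N / (u - v)"
    by (simp add: power_divide distrib_left mult.commute)
  with Suc show ?case by simp
qed simp

text \<open>One form serves both kinds of expansion: \<open>u\<close> constant and
  \<open>v = z\<close> gives powers of z, \<open>u = z - w\<close> and \<open>v\<close> constant
  gives powers of 1 / (z - w). The ratio \<rho> makes the remainder geometric, and \<open>m\<close>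
  keeps its denominator away from 0.\<close>

lemma rational_limit_geometric:
  assumes "K \<subseteq> \<Omega>" "0 \<le> \<rho>" "\<rho> < 1" "m > 0"
    and le: "\<And>z. z \<in> K \<Longrightarrow> cmod (v z) \<le> \<rho> * cmod (u z)" "\<And>z. z \<in> K \<Longrightarrow> m \<le> cmod (u z)"
    and lim: "\<And>k. rational_limit \<Omega> K (\<lambda>z. v z ^ k / u z ^ Suc k)"
  shows "rational_limit \<Omega> K (\<lambda>z. 1 / (u z - v z))"
proof (rule rational_limit_limit)
  fix e :: real assume "e > 0"
  \<comment> \<open>A lower bound for |u - v| on K by the reverse triangle inequality, so the
    remainder after N terms is at most \<rho>^N / M.\<close>
  define M where "M = (1 - \<rho>) * m"
  have "M > 0" using assms by (simp add: M_def)
  then obtain N where N: "\<rho> ^ N < e * M"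
    using real_arch_pow_inv[of "e * M" \<rho>] \<open>e > 0\<close> assms(3) by auto
  have "cmod (1 / (u z - v z) - (\<Sum>k<N. v z ^ k / u z ^ Suc k)) < e" if z: "z \<in> K" for z
  proof -
    have u: "cmod (u z) > 0" using le(2)[OF z] \<open>m > 0\<close> by linarith
    have "M \<le> (1 - \<rho>) * cmod (u z)"
      unfolding M_def using assms(3) le(2)[OF z] by (intro mult_left_mono) auto
    also have "\<dots> \<le> cmod (u z) - cmod (v z)" using le(1)[OF z] by (simp add: algebra_simps)
    also have "\<dots> \<le> cmod (u z - v z)" by (rule norm_triangle_ineq2)
    finally have M: "M \<le> cmod (u z - v z)" .
    have "1 / (u z - v z) - (\<Sum>k<N. v z ^ k / u z ^ Suc k) = (v z / u z) ^ N / (u z - v z)"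
      using geometric_remainder[of "u z" "v z" N] u M \<open>M > 0\<close> by fastforce
    also have "cmod \<dots> = (cmod (v z) / cmod (u z)) ^ N / cmod (u z - v z)"
      by (simp add: norm_divide norm_power)
    also have "\<dots> \<le> \<rho> ^ N / M"
      using M \<open>M > 0\<close> le(1)[OF z] u by (intro frac_le power_mono) (auto simp: divide_le_eq assms(2))
    also have "\<dots> < e" using N \<open>M > 0\<close> by (simp add: divide_less_eq)
    finally show ?thesis .
  qed
  then show "\<exists>h. rational_limit \<Omega> K h \<and> (\<forall>z\<in>K. cmod (1 / (u z - v z) - h z) < e)"
    using rational_limit_sum[of K \<Omega> "{..<N}" "\<lambda>k z. v z ^ k / u z ^ Suc k"] assms(1) lim by blast
qed

text \<open>
  A point \<open>b\<close> outside the \<open>n\<close>-th set of this exhaustion satisfies \<open>\<bar>b\<bar> > n\<close> or lies within \<open>1 / (n + 1)\<close>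
  of some \<open>w \<notin> \<Omega>\<close>, so \<open>1 / (z - b)\<close> expands on that set into a single geometric series, in powers of \<open>z\<close>
  or of \<open>1 / (z - w)\<close>. This replaces the usual pole pushing along paths in Runge's theorem.
\<close>

definition exhaustion :: "complex set \<Rightarrow> nat \<Rightarrow> complex set" where
  "exhaustion \<Omega> n = {z. cmod z \<le> real n \<and> (\<forall>w. w \<notin> \<Omega> \<longrightarrow> 1 / real (Suc n) \<le> cmod (z - w))}"

lemma exhaustion_subset: "exhaustion \<Omega> n \<subseteq> \<Omega>"
proof
  fix z assume z: "z \<in> exhaustion \<Omega> n"
  show "z \<in> \<Omega>"
  proof (rule ccontr)
    assume "z \<notin> \<Omega>"
    with z have "1 / real (Suc n) \<le> cmod (z - z)" unfolding exhaustion_def by blast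
    then show False by (simp add: field_simps)
  qed
qed

lemma compact_exhaustion: "compact (exhaustion \<Omega> n)"
proof -
  have "exhaustion \<Omega> n = cball 0 (real n) \<inter> (\<Inter>w\<in>-\<Omega>. - ball w (1 / real (Suc n)))"
    by (auto simp: exhaustion_def dist_norm norm_minus_commute not_less)
  also have "compact \<dots>" by (intro compact_Int_closed compact_cball closed_INT) auto
  finally show ?thesis .
qed

lemma exhaustion_mono: "m \<le> n \<Longrightarrow> exhaustion \<Omega> m \<subseteq> exhaustion \<Omega> n"
proof -
  assume "m \<le> n"
  then have "real m \<le> real n" "1 / real (Suc n) \<le> 1 / real (Suc m)" by (auto simp: frac_le)
  then show ?thesis unfolding exhaustion_def by force
qed

lemma compact_subset_exhaustion:
  assumes "open \<Omega>" "compact K" "K \<subseteq> \<Omega>"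
  obtains n where "K \<subseteq> exhaustion \<Omega> n"
proof -
  obtain b where b: "\<And>z. z \<in> K \<Longrightarrow> cmod z \<le> b"
    using compact_imp_bounded[OF assms(2)] unfolding bounded_iff by blast
  obtain d where d: "d > 0" "\<forall>z\<in>K. \<forall>w\<in>-\<Omega>. d \<le> dist z w"
    using separate_compact_closed[of K "-\<Omega>"] assms by (metis Compl_disjoint2 closed_Compl disjoint_eq_subset_Compl double_compl)
  obtain n :: nat where n: "real n > max b (1 / d)" using reals_Archimedean2 by blast
  have "1 / real (Suc n) \<le> d"
  proof -
    have "1 / d < real (Suc n)" using n by simp
    then show ?thesis using d(1) by (simp add: field_simps)
  qed
  then have "K \<subseteq> exhaustion \<Omega> n"
    unfolding exhaustion_def using b d(2) n by (force simp: dist_norm)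
  then show ?thesis using that by blast
qed

lemma rational_limit_pole:
  assumes "b \<notin> exhaustion \<Omega> n"
  shows "rational_limit \<Omega> (exhaustion \<Omega> n) (\<lambda>z. 1 / (b - z))"
proof (cases "cmod b \<le> real n")
  case False
  show ?thesis
  proof (rule rational_limit_geometric[where \<rho> = "real n / cmod b" and m = "cmod b"])
    show "rational_limit \<Omega> (exhaustion \<Omega> n) (\<lambda>z. z ^ k / b ^ Suc k)" for k
      using False by (intro rational_limit_exact[where A = "monom 1 k" and B = "[:b ^ Suc k:]"]) (auto simp: poly_monom)
    show "real n / cmod b < 1" using False by (simp add: divide_less_eq)
    show "cmod b > 0" using False by (smt (verit) of_nat_0_le_iff)
    show "exhaustion \<Omega> n \<subseteq> \<Omega>" by (rule exhaustion_subset)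
  qed (use False in \<open>auto simp: exhaustion_def\<close>)
next
  case True
  then obtain w where w: "w \<notin> \<Omega>" "cmod (b - w) < 1 / real (Suc n)"
    using assms unfolding exhaustion_def by force
  have "rational_limit \<Omega> (exhaustion \<Omega> n) (\<lambda>z. 1 / ((z - w) - (b - w)))"
  \<comment> \<open>No point of the set is closer to w than 1 / (n + 1), whereas b is; hence the
    ratio is below 1.\<close>
  proof (rule rational_limit_geometric[where \<rho> = "cmod (b - w) * real (Suc n)" and m = "1 / real (Suc n)"])
    show "rational_limit \<Omega> (exhaustion \<Omega> n) (\<lambda>z. (b - w) ^ k / (z - w) ^ Suc k)" for k
      using w(1) by (intro rational_limit_exact[where A = "[:(b - w) ^ k:]" and B = "[:-w, 1:] ^ Suc k"]) (auto simp del: power_Suc)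
    show "cmod (b - w) * real (Suc n) < 1" using w(2) by (simp add: field_simps)
    show ge: "1 / real (Suc n) \<le> cmod (z - w)" if "z \<in> exhaustion \<Omega> n" for z
      using that w(1) unfolding exhaustion_def by blast
    show "cmod (b - w) \<le> cmod (b - w) * real (Suc n) * cmod (z - w)" if "z \<in> exhaustion \<Omega> n" for z
    proof -
      have "1 \<le> real (Suc n) * cmod (z - w)" using ge[OF that] by (simp add: field_simps)
      then show ?thesis using mult_left_mono[of 1 _ "cmod (b - w)"] by (simp add: mult.assoc)
    qed
  qed (use exhaustion_subset in auto)
  then have "rational_limit \<Omega> (exhaustion \<Omega> n) (\<lambda>z. -1 * (1 / (z - b)))"
    by (intro rational_limit_cmult) simp
  then show ?thesis
    by (rule rational_limit_cong[rotated]) (metis minus_diff_eq minus_divide_right mult_minus1)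
qed

section \<open>Cauchy integrals as uniform limits of Riemann sums\<close>

lemma integral_unit_interval_split:
  fixes f :: "real \<Rightarrow> complex"
  assumes "continuous_on {0..1} f" "m \<le> N"
  shows "integral {0..real m / real N} f = (\<Sum>k<m. integral {real k / real N..real (Suc k) / real N} f)"
  using assms(2)
proof (induction m)
  case (Suc m)
  have "real (Suc m) / real N \<le> 1" using Suc.prems by simp
  then have int: "f integrable_on {0..real (Suc m) / real N}"
    by (intro integrable_continuous_real continuous_on_subset[OF assms(1)]) auto
  have "integral {0..real m / real N} f + integral {real m / real N..real (Suc m) / real N} f
        = integral {0..real (Suc m) / real N} f"
    by (intro Henstock_Kurzweil_Integration.integral_combine int) (auto simp: divide_right_mono)
  with Suc show ?case by simp
qed simp

text \<open>Joint uniform continuity on the compact product gives one mesh that works for every z in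
  K at once.\<close>

lemma uniform_Riemann_sum:
  fixes \<phi> :: "real \<Rightarrow> complex \<Rightarrow> complex"
  assumes "compact K" "continuous_on ({0..1} \<times> K) (\<lambda>(t, z). \<phi> t z)" "e > 0"
  obtains N :: nat where "N > 0"
    "\<And>z. z \<in> K \<Longrightarrow> cmod (integral {0..1} (\<lambda>t. \<phi> t z) - (\<Sum>k<N. \<phi> (real k / real N) z / of_nat N)) \<le> e"
proof -
  have "uniformly_continuous_on ({0..1} \<times> K) (\<lambda>(t, z). \<phi> t z)"
    by (intro compact_uniformly_continuous assms compact_Times) auto
  then obtain d where d: "d > 0"
    "\<And>t z t' z'. t \<in> {0..1} \<Longrightarrow> z \<in> K \<Longrightarrow> t' \<in> {0..1} \<Longrightarrow> z' \<in> K \<Longrightarrow> dist (t', z') (t, z) < d \<Longrightarrow> dist (\<phi> t' z') (\<phi> t z) < e"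
    using \<open>e > 0\<close> unfolding uniformly_continuous_on_def by (auto simp: Ball_def)
  obtain N :: nat where N: "N > 0" "1 / real N < d"
    using d(1) by (metis nat_approx_posE of_nat_Suc zero_less_Suc)
  have "cmod (integral {0..1} (\<lambda>t. \<phi> t z) - (\<Sum>k<N. \<phi> (real k / real N) z / of_nat N)) \<le> e" if z: "z \<in> K" for z
  proof -
    have "continuous_on {0..1} ((\<lambda>(t, z). \<phi> t z) \<circ> (\<lambda>t. (t, z)))"
      using z by (intro continuous_on_compose continuous_on_subset[OF assms(2)] continuous_intros) auto
    then have cont: "continuous_on {0..1} (\<lambda>t. \<phi> t z)" by (simp add: o_def)
    have piece: "cmod (integral {real k / real N..real (Suc k) / real N} (\<lambda>t. \<phi> t z) - \<phi> (real k / real N) z / of_nat N) \<le> e * (1 / real N)"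
      if "k < N" for k
    proof -
      have sub: "{real k / real N..real (Suc k) / real N} \<subseteq> {0..1}"
      proof -
        have "real (Suc k) / real N \<le> 1" using that by simp
        then show ?thesis by (auto intro: order_trans[of 0 "real k / real N"])
      qed
      have len: "real (Suc k) / real N - real k / real N = 1 / real N"
        by (simp add: diff_divide_distrib[symmetric])
      have le: "real k / real N \<le> real (Suc k) / real N" by (simp add: divide_right_mono)
      have int: "(\<lambda>t. \<phi> t z) integrable_on {real k / real N..real (Suc k) / real N}"
        by (intro integrable_continuous_real continuous_on_subset[OF cont] sub)
      have "integral {real k / real N..real (Suc k) / real N} (\<lambda>t. \<phi> t z) - \<phi> (real k / real N) z / of_nat N
          = integral {real k / real N..real (Suc k) / real N} (\<lambda>t. \<phi> t z - \<phi> (real k / real N) z)"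
        using int le len by (subst integral_diff) (auto simp: scaleR_conv_of_real)
      also have "cmod \<dots> \<le> e * (real (Suc k) / real N - real k / real N)"
      proof (rule integral_bound)
        show "continuous_on {real k / real N..real (Suc k) / real N} (\<lambda>t. \<phi> t z - \<phi> (real k / real N) z)"
          by (intro continuous_intros continuous_on_subset[OF cont] sub)
        fix t assume t: "t \<in> {real k / real N..real (Suc k) / real N}"
        have "dist (\<phi> t z) (\<phi> (real k / real N) z) < e"
        proof (rule d(2))
          show "t \<in> {0..1}" using t sub by blast
          show "real k / real N \<in> {0..1}" using le sub by (metis atLeastAtMost_iff order_refl subsetD)
          have "\<bar>t - real k / real N\<bar> < d" using t len N(2) by auto
          then show "dist (t, z) (real k / real N, z) < d" by (simp add: dist_Pair_Pair dist_real_def)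
        qed (use z in auto)
        then show "cmod (\<phi> t z - \<phi> (real k / real N) z) \<le> e" by (simp add: dist_norm)
      qed (rule le)
      finally show ?thesis using len by simp
    qed
    have "integral {0..1} (\<lambda>t. \<phi> t z) = (\<Sum>k<N. integral {real k / real N..real (Suc k) / real N} (\<lambda>t. \<phi> t z))"
      using integral_unit_interval_split[OF cont, of N N] N(1) by simp
    then have "cmod (integral {0..1} (\<lambda>t. \<phi> t z) - (\<Sum>k<N. \<phi> (real k / real N) z / of_nat N))
       = cmod (\<Sum>k<N. integral {real k / real N..real (Suc k) / real N} (\<lambda>t. \<phi> t z) - \<phi> (real k / real N) z / of_nat N)"
      by (simp add: sum_subtractf)
    also have "\<dots> \<le> (\<Sum>k<N. e * (1 / real N))" by (intro sum_norm_le piece) auto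
    also have "\<dots> = e" using N(1) by simp
    finally show ?thesis .
  qed
  with N(1) show ?thesis using that by blast
qed

text \<open>Each term of a Riemann sum is a constant times 1 / (w - z) with w on the segment, hence
  off K, and \<open>rational_limit_pole\<close> applies to it.\<close>

lemma rational_limit_segment_integral:
  fixes \<Omega> n defines "K \<equiv> exhaustion \<Omega> n"
  assumes "continuous_on (closed_segment a b) g" "closed_segment a b \<inter> K = {}"
  shows "rational_limit \<Omega> K (\<lambda>z. contour_integral (linepath a b) (\<lambda>w. g w / (w - z)))"
proof (rule rational_limit_limit)
  fix e :: real assume "e > 0"
  \<comment> \<open>The factor b - a is the derivative of \<open>linepath a b\<close>, so \<phi> is
    the integrand over [0, 1].\<close>
  define \<phi> where "\<phi> = (\<lambda>t z. g (linepath a b t) / (linepath a b t - z) * (b - a))"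
  have seg: "linepath a b t \<in> closed_segment a b" if "t \<in> {0..1}" for t
    using that by (metis image_eqI path_image_def path_image_linepath)
  have "continuous_on ({0..1} \<times> K) (\<lambda>x. g (linepath a b (fst x)) / (linepath a b (fst x) - snd x) * (b - a))"
  proof (intro continuous_intros)
    show "continuous_on ({0..1} \<times> K) (\<lambda>x. g (linepath a b (fst x)))"
      by (rule continuous_on_compose2[OF assms(2)])
         (use seg in \<open>auto simp: linepath_def intro!: continuous_intros\<close>)
    show "continuous_on ({0..1} \<times> K) (\<lambda>x. linepath a b (fst x))"
      unfolding linepath_def by (intro continuous_intros)
    show "\<forall>x\<in>{0..1} \<times> K. linepath a b (fst x) - snd x \<noteq> 0" using seg assms(3) by fastforce
  qed
  then have "continuous_on ({0..1} \<times> K) (\<lambda>(t, z). \<phi> t z)"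
    by (simp add: \<phi>_def case_prod_unfold)
  then obtain N :: nat where N: "N > 0"
    "\<And>z. z \<in> K \<Longrightarrow> cmod (integral {0..1} (\<lambda>t. \<phi> t z) - (\<Sum>k<N. \<phi> (real k / real N) z / of_nat N)) \<le> e / 2"
    using uniform_Riemann_sum[of K \<phi> "e / 2"] compact_exhaustion \<open>e > 0\<close> unfolding K_def by auto
  have "rational_limit \<Omega> K (\<lambda>z. \<Sum>k<N. \<phi> (real k / real N) z / of_nat N)"
  proof (rule rational_limit_sum)
    show "K \<subseteq> \<Omega>" unfolding K_def by (rule exhaustion_subset)
    fix k assume "k \<in> {..<N}"
    then have "linepath a b (real k / real N) \<notin> K" using seg[of "real k / real N"] assms(3) by auto
    then have "rational_limit \<Omega> K (\<lambda>z. g (linepath a b (real k / real N)) * (b - a) / of_nat N *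
         (1 / (linepath a b (real k / real N) - z)))"
      unfolding K_def by (intro rational_limit_cmult rational_limit_pole)
    then show "rational_limit \<Omega> K (\<lambda>z. \<phi> (real k / real N) z / of_nat N)"
      by (rule rational_limit_cong[rotated]) (simp add: \<phi>_def mult_ac)
  qed
  moreover have "contour_integral (linepath a b) (\<lambda>w. g w / (w - z)) = integral {0..1} (\<lambda>t. \<phi> t z)" for z
    by (simp add: contour_integral_integral \<phi>_def)
  ultimately show "\<exists>h. rational_limit \<Omega> K h \<and> (\<forall>z\<in>K. cmod (contour_integral (linepath a b) (\<lambda>w. g w / (w - z)) - h z) < e)"
    using N(2) \<open>e > 0\<close> by (intro exI[of _ "\<lambda>z. \<Sum>k<N. \<phi> (real k / real N) z / of_nat N"]) fastforce
qed


text \<open>Differentiation under the integral sign even gives a complex derivative off the segment,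
  with g merely continuous on it.\<close>

lemma segment_integral_continuous:
  assumes "continuous_on (closed_segment a b) g" "z \<notin> closed_segment a b"
  shows "isCont (\<lambda>z. contour_integral (linepath a b) (\<lambda>w. g w / (w - z))) z"
proof -
  have int: "(\<lambda>w. g w / (w - y)) contour_integrable_on linepath a b" if "y \<notin> closed_segment a b" for y
    using that by (intro contour_integrable_continuous_linepath continuous_intros assms) auto
  have "((\<lambda>z. contour_integral (linepath a b) (\<lambda>w. g w / (w - z))) has_field_derivative
      of_nat 1 * contour_integral (linepath a b) (\<lambda>w. g w / (w - z) ^ Suc 1)) (at z)"
  proof (rule Cauchy_next_derivative(2))
    show "norm (vector_derivative (linepath a b) (at t)) \<le> norm (b - a)" for t by simp
    show "open (UNIV :: complex set)" by simp
    show "((\<lambda>u. g u / (u - w) ^ 1) has_contour_integral contour_integral (linepath a b) (\<lambda>u. g u / (u - w))) (linepath a b)"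
      if "w \<in> UNIV - path_image (linepath a b)" for w
      using has_contour_integral_integral[OF int[of w]] that by simp
  qed (use assms in auto)
  then show ?thesis using DERIV_isCont by blast
qed

text \<open>Opposite sides are traversed in the same direction, so that the top side of one square
  is literally the bottom side of the square above it and cancellation means cancelling equal
  terms.\<close>

lemma rectangle_integral_split:
  fixes g :: "complex \<Rightarrow> complex"
  assumes "continuous_on (path_image (rectpath (Complex x y) (Complex x' y'))) g"
  shows "contour_integral (rectpath (Complex x y) (Complex x' y')) g =
     (contour_integral (linepath (Complex x y) (Complex x' y)) g - contour_integral (linepath (Complex x y') (Complex x' y')) g)
   + (contour_integral (linepath (Complex x' y) (Complex x' y')) g - contour_integral (linepath (Complex x y) (Complex x y')) g)"
proof -
  define a b c d where abcd: "a = Complex x y" "b = Complex x' y" "c = Complex x' y'" "d = Complex x y'"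
  have rp: "rectpath a c = linepath a b +++ linepath b c +++ linepath c d +++ linepath d a"
    by (simp add: rectpath_def Let_def abcd)
  have "path_image (rectpath a c) = closed_segment a b \<union> closed_segment b c \<union> closed_segment c d \<union> closed_segment d a"
    unfolding rp by (simp add: path_image_join Un_assoc)
  then have "continuous_on (closed_segment a b) g" "continuous_on (closed_segment b c) g"
    "continuous_on (closed_segment c d) g" "continuous_on (closed_segment d a) g"
    using assms unfolding abcd by (auto intro: continuous_on_subset)
  then have int: "g contour_integrable_on linepath a b" "g contour_integrable_on linepath b c"
    "g contour_integrable_on linepath c d" "g contour_integrable_on linepath d a"
    by (auto intro: contour_integrable_continuous_linepath)
  have "contour_integral (rectpath a c) g = contour_integral (linepath a b) g + contour_integral (linepath b c) g
      + contour_integral (linepath c d) g + contour_integral (linepath d a) g"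
    unfolding rp using int by (simp add: valid_path_join)
  moreover have "contour_integral (linepath c d) g = - contour_integral (linepath d c) g"
    "contour_integral (linepath d a) g = - contour_integral (linepath a d) g"
    using contour_integral_reversepath[of "linepath c d" g] contour_integral_reversepath[of "linepath d a" g] by simp_all
  ultimately show ?thesis unfolding abcd by simp
qed


text \<open>Used with T the set of squares of S shifted by one step: the common terms stand for
  edges shared by two squares of S, and only boundary edges survive.\<close>

lemma sum_diff_symmetric:
  fixes f :: "'a \<Rightarrow> 'b::ab_group_add"
  assumes "finite S" "finite T"
  shows "sum f S - sum f T = sum f (S - T) - sum f (T - S)"
proof -
  have "sum f S = sum f (S - T) + sum f (S \<inter> T)" "sum f T = sum f (T - S) + sum f (S \<inter> T)"
    using sum.Int_Diff[OF assms(1), of f T] sum.Int_Diff[OF assms(2), of f S] by (simp_all add: Int_commute add.commute)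
  then show ?thesis by simp
qed

text \<open>
  Cauchy's formula is summed over the squares of a fine grid that meet \<open>K\<close>. An edge that meets \<open>K\<close>
  belongs to two such squares and cancels; the remaining edges lie in \<open>\<Omega> - K\<close>. Points of \<open>K\<close> on
  the grid are reached by continuity from the interior of a square.
\<close>

theorem Runge_exhaustion:
  assumes "open \<Omega>" "g holomorphic_on \<Omega>"
  shows "rational_limit \<Omega> (exhaustion \<Omega> n) g"
proof -
  define K where "K = exhaustion \<Omega> n"
  have K: "compact K" "K \<subseteq> \<Omega>" by (simp_all add: K_def compact_exhaustion exhaustion_subset)
  obtain d where d: "d > 0" "\<And>z w. z \<in> K \<Longrightarrow> w \<notin> \<Omega> \<Longrightarrow> d \<le> dist z w"
    using separate_compact_closed[of K "-\<Omega>"] K assms(1)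
    by (metis ComplI Compl_disjoint2 closed_Compl disjoint_eq_subset_Compl double_compl)
  \<comment> \<open>Two points of a square of side \<delta> are at most 2 \<delta> < d apart, so a
    square that meets K stays in \<Omega>.\<close>
  define \<delta> where "\<delta> = d / 3"
  have \<delta>: "\<delta> > 0" "2 * \<delta> < d" using d(1) by (auto simp: \<delta>_def)
  define v where "v = (\<lambda>i j :: int. Complex (\<delta> * of_int i) (\<delta> * of_int j))"
  define Q where "Q = (\<lambda>i j. cbox (v i j) (v (i + 1) (j + 1)))"
  define S where "S = {p. Q (fst p) (snd p) \<inter> K \<noteq> {}}"
  have Q_iff: "x \<in> Q i j \<longleftrightarrow> \<delta> * of_int i \<le> Re x \<and> Re x \<le> \<delta> * of_int i + \<delta> \<and>
      \<delta> * of_int j \<le> Im x \<and> Im x \<le> \<delta> * of_int j + \<delta>" for x i j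
    by (auto simp: Q_def v_def in_cbox_complex_iff algebra_simps)
  have convQ: "convex (Q i j)" for i j by (simp add: Q_def convex_box)
  have Q_sub: "Q i j \<subseteq> \<Omega>" if ij: "(i, j) \<in> S" for i j
  proof
    fix x assume x: "x \<in> Q i j"
    obtain z where z: "z \<in> Q i j" "z \<in> K" using ij unfolding S_def by auto
    have "dist z x \<le> \<bar>Re (z - x)\<bar> + \<bar>Im (z - x)\<bar>" unfolding dist_norm by (rule cmod_le)
    also have "\<dots> \<le> \<delta> + \<delta>" using x z(1) unfolding Q_iff by (intro add_mono) auto
    finally have "dist z x < d" using \<delta> by simp
    then show "x \<in> \<Omega>" using d(2)[OF z(2), of x] by linarith
  qed
  \<comment> \<open>This serves finiteness only. The lower bound is reduced by one because it is the
    far side of the square, at \<delta> (i + 1), that has to reach -n.\<close>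
  have "S \<subseteq> {\<lfloor>- real n / \<delta>\<rfloor> - 1..\<lceil>real n / \<delta>\<rceil>} \<times> {\<lfloor>- real n / \<delta>\<rfloor> - 1..\<lceil>real n / \<delta>\<rceil>}"
  proof
    fix p assume "p \<in> S"
    then obtain z where z: "z \<in> Q (fst p) (snd p)" "z \<in> K" unfolding S_def by auto
    have "cmod z \<le> real n" using z(2) by (simp add: K_def exhaustion_def)
    then have "\<bar>Re z\<bar> \<le> real n" "\<bar>Im z\<bar> \<le> real n"
      using abs_Re_le_cmod[of z] abs_Im_le_cmod[of z] by linarith+
    then have "\<delta> * of_int (fst p) \<le> real n" "- real n \<le> \<delta> * (of_int (fst p) + 1)"
      "\<delta> * of_int (snd p) \<le> real n" "- real n \<le> \<delta> * (of_int (snd p) + 1)"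
      using z(1) unfolding Q_iff by (auto simp: algebra_simps)
    then have "of_int (fst p) \<le> real n / \<delta>" "- real n / \<delta> \<le> of_int (fst p) + 1"
      "of_int (snd p) \<le> real n / \<delta>" "- real n / \<delta> \<le> of_int (snd p) + 1"
      using \<delta>(1) by (simp_all add: field_simps)
    then show "p \<in> {\<lfloor>- real n / \<delta>\<rfloor> - 1..\<lceil>real n / \<delta>\<rceil>} \<times> {\<lfloor>- real n / \<delta>\<rfloor> - 1..\<lceil>real n / \<delta>\<rceil>}"
      by (simp add: mem_Times_iff) linarith
  qed
  then have finS: "finite S" by (rule finite_subset) simp
  \<comment> \<open>\<open>B\<close> and \<open>L\<close> integrate over the bottom and the left
    edge of a square. Its top edge is the bottom edge of \<open>up p\<close> and its right edge the
    left edge of \<open>right p\<close>, so every edge has just one name.\<close>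
  define B where "B = (\<lambda>z p. contour_integral (linepath (v (fst p) (snd p)) (v (fst p + 1) (snd p))) (\<lambda>w. g w / (w - z)))"
  define L where "L = (\<lambda>z p. contour_integral (linepath (v (fst p) (snd p)) (v (fst p) (snd p + 1))) (\<lambda>w. g w / (w - z)))"
  define up right :: "int \<times> int \<Rightarrow> int \<times> int"
    where "up = (\<lambda>p. (fst p, snd p + 1))" and "right = (\<lambda>p. (fst p + 1, snd p))"
  have inj: "inj up" "inj right" by (auto simp: inj_on_def up_def right_def)
  have mem_up: "p \<in> up ` S \<longleftrightarrow> (fst p, snd p - 1) \<in> S" for p
    by (cases p) (force simp: up_def)
  have mem_right: "p \<in> right ` S \<longleftrightarrow> (fst p - 1, snd p) \<in> S" for p
    by (cases p) (force simp: right_def)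
  \<comment> \<open>The boundary edges that survive the cancellation; \<open>H_eq\<close> identifies
    this with the sum over all squares of S.\<close>
  define H where "H = (\<lambda>z. ((\<Sum>p\<in>S - up ` S. B z p) - (\<Sum>p\<in>up ` S - S. B z p)) +
     ((\<Sum>p\<in>right ` S - S. L z p) - (\<Sum>p\<in>S - right ` S. L z p)))"
  have H_eq: "H z = (\<Sum>p\<in>S. (B z p - B z (up p)) + (L z (right p) - L z p))" for z
  proof -
    have "sum (B z) (up ` S) = (\<Sum>p\<in>S. B z (up p))" "sum (L z) (right ` S) = (\<Sum>p\<in>S. L z (right p))"
      using inj by (simp_all add: sum.reindex inj_on_subset[OF _ subset_UNIV])
    then show ?thesis unfolding H_def
      using finS by (simp add: sum_diff_symmetric[symmetric] sum.distrib sum_subtractf)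
  qed
  \<comment> \<open>A point of an open square lies in no other closed square of the grid. Its own
    square contributes by Cauchy's formula, and the others vanish by Cauchy's theorem.\<close>
  have H_box: "H z = 2 * of_real pi * \<i> * g z" 
    if ij: "(i, j) \<in> S" and zbox: "z \<in> box (v i j) (v (i + 1) (j + 1))" for z i j
  proof -
    have "(B z p - B z (up p)) + (L z (right p) - L z p) = (if p = (i, j) then 2 * of_real pi * \<i> * g z else 0)" 
      if p: "p \<in> S" for p
    proof -
      obtain k l where [simp]: "p = (k, l)" by (cases p)
      let ?r = "rectpath (v k l) (v (k + 1) (l + 1))"
      have r: "path_image ?r \<subseteq> Q k l"
        unfolding Q_def by (intro path_image_rectpath_subset_cbox) (use \<delta>(1) in \<open>auto simp: v_def\<close>)
      have holQ: "g holomorphic_on Q k l" using Q_sub p assms(2) by (auto intro: holomorphic_on_subset)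
      have other: "z \<notin> Q k l" if "p \<noteq> (i, j)"
      proof
        assume "z \<in> Q k l"
        then have "\<delta> * of_int k < \<delta> * (of_int i + 1)" "\<delta> * of_int i < \<delta> * (of_int k + 1)"
          "\<delta> * of_int l < \<delta> * (of_int j + 1)" "\<delta> * of_int j < \<delta> * (of_int l + 1)"
          using zbox unfolding Q_iff by (auto simp: v_def in_box_complex_iff algebra_simps)
        then have "of_int k < (of_int i + 1 :: real)" "of_int i < (of_int k + 1 :: real)"
          "of_int l < (of_int j + 1 :: real)" "of_int j < (of_int l + 1 :: real)"
          using \<delta>(1) by simp_all
        then have "k = i" "l = j" by linarith+
        with that show False by simp
      qed
      have notin: "z \<notin> path_image ?r"
      proof (cases "p = (i, j)")
        case True
        then show ?thesis
          using zbox path_image_rectpath_inter_box[of "v i j" "v (i + 1) (j + 1)"] \<delta>(1) by (auto simp: v_def)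
      qed (use other r in auto)
      have cont: "continuous_on (path_image ?r) (\<lambda>w. g w / (w - z))"
        by (intro continuous_intros continuous_on_subset[OF holomorphic_on_imp_continuous_on[OF holQ] r])
          (use notin in auto)
      have "contour_integral ?r (\<lambda>w. g w / (w - z)) = (B z p - B z (up p)) + (L z (right p) - L z p)"
        unfolding B_def L_def up_def right_def v_def
        using rectangle_integral_split[of "\<delta> * of_int k" "\<delta> * of_int l" "\<delta> * of_int (k + 1)" "\<delta> * of_int (l + 1)" "\<lambda>w. g w / (w - z)"]
          cont
        by (simp add: v_def)
      moreover have "((\<lambda>w. g w / (w - z)) has_contour_integral (if p = (i, j) then 2 * of_real pi * \<i> * g z else 0)) ?r"
      proof (cases "p = (i, j)")
        case True
        then have z: "z \<in> box (v k l) (v (k + 1) (l + 1))" using zbox by simp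
        then have "z \<in> interior (Q k l)" by (simp add: Q_def)
        then have "((\<lambda>w. g w / (w - z)) has_contour_integral (2 * pi * \<i> * winding_number ?r z * g z)) ?r"
          by (rule Cauchy_integral_formula_convex_simple[OF convQ holQ]) (use r notin in auto)
        then show ?thesis using winding_number_rectpath[OF z] True by simp
      next
        case False
        have "(\<lambda>w. g w / (w - z)) holomorphic_on Q k l"
          using other[OF False] holQ by (intro holomorphic_intros) auto
        then have "((\<lambda>w. g w / (w - z)) has_contour_integral 0) ?r"
          by (rule Cauchy_theorem_convex_simple[OF _ convQ _ r]) auto
        then show ?thesis by (simp only: if_not_P[OF False])
      qed
      ultimately show ?thesis by (simp only: contour_integral_unique)
    qed
    then show ?thesis unfolding H_eq using ij finS by simp
  qed
  \<comment> \<open>The edge lies in both adjacent squares. The one in S is contained in \<Omega>,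
    and the one not in S misses K.\<close>
  have B_edge: "closed_segment (v i j) (v (i + 1) j) \<subseteq> \<Omega> - K" if "((i, j) \<in> S) \<noteq> ((i, j - 1) \<in> S)" for i j
  proof -
    have "closed_segment (v i j) (v (i + 1) j) \<subseteq> Q i j"
      by (rule closed_segment_subset[OF _ _ convQ]; use \<delta>(1) in \<open>simp add: Q_iff v_def algebra_simps\<close>)+
    moreover have "closed_segment (v i j) (v (i + 1) j) \<subseteq> Q i (j - 1)"
      by (rule closed_segment_subset[OF _ _ convQ]; use \<delta>(1) in \<open>simp add: Q_iff v_def algebra_simps\<close>)+
    ultimately show ?thesis using that Q_sub[of i j] Q_sub[of i "j - 1"] by (auto simp: S_def)
  qed
  have L_edge: "closed_segment (v i j) (v i (j + 1)) \<subseteq> \<Omega> - K" if "((i, j) \<in> S) \<noteq> ((i - 1, j) \<in> S)" for i j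
  proof -
    have "closed_segment (v i j) (v i (j + 1)) \<subseteq> Q i j"
      by (rule closed_segment_subset[OF _ _ convQ]; use \<delta>(1) in \<open>simp add: Q_iff v_def algebra_simps\<close>)+
    moreover have "closed_segment (v i j) (v i (j + 1)) \<subseteq> Q (i - 1) j"
      by (rule closed_segment_subset[OF _ _ convQ]; use \<delta>(1) in \<open>simp add: Q_iff v_def algebra_simps\<close>)+
    ultimately show ?thesis using that Q_sub[of i j] Q_sub[of "i - 1" j] by (auto simp: S_def)
  qed
  have cont_g: "continuous_on A g" if "A \<subseteq> \<Omega> - K" for A
    using that holomorphic_on_imp_continuous_on[OF assms(2)] by (auto intro: continuous_on_subset)
  have B_sub: "closed_segment (v (fst p) (snd p)) (v (fst p + 1) (snd p)) \<subseteq> \<Omega> - K"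
    if "p \<in> (S - up ` S) \<union> (up ` S - S)" for p
    using B_edge[of "fst p" "snd p"] that mem_up[of p] by auto
  have L_sub: "closed_segment (v (fst p) (snd p)) (v (fst p) (snd p + 1)) \<subseteq> \<Omega> - K"
    if "p \<in> (S - right ` S) \<union> (right ` S - S)" for p
    using L_edge[of "fst p" "snd p"] that mem_right[of p] by auto
  have B_lim: "rational_limit \<Omega> K (\<lambda>z. B z p)" if "p \<in> (S - up ` S) \<union> (up ` S - S)" for p
    unfolding B_def K_def
    by (rule rational_limit_segment_integral) (use cont_g[OF B_sub[OF that]] B_sub[OF that] K_def in auto)
  have L_lim: "rational_limit \<Omega> K (\<lambda>z. L z p)" if "p \<in> (S - right ` S) \<union> (right ` S - S)" for p
    unfolding L_def K_def
    by (rule rational_limit_segment_integral) (use cont_g[OF L_sub[OF that]] L_sub[OF that] K_def in auto)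
  have lim_H: "rational_limit \<Omega> K H"
    unfolding H_def
    by (intro rational_limit_add rational_limit_diff rational_limit_sum B_lim L_lim K(2)) simp_all
  have B_cont: "isCont (\<lambda>z. B z p) z" if "p \<in> (S - up ` S) \<union> (up ` S - S)" "z \<in> K" for z p
    unfolding B_def
    by (rule segment_integral_continuous) (use cont_g[OF B_sub[OF that(1)]] B_sub[OF that(1)] that(2) in auto)
  have L_cont: "isCont (\<lambda>z. L z p) z" if "p \<in> (S - right ` S) \<union> (right ` S - S)" "z \<in> K" for z p
    unfolding L_def
    by (rule segment_integral_continuous) (use cont_g[OF L_sub[OF that(1)]] L_sub[OF that(1)] that(2) in auto)
  have "g z = 1 / (2 * of_real pi * \<i>) * H z" if z: "z \<in> K" for z
  proof -
    define i j where "i = \<lfloor>Re z / \<delta>\<rfloor>" and "j = \<lfloor>Im z / \<delta>\<rfloor>"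
    have "of_int i \<le> Re z / \<delta>" "Re z / \<delta> \<le> of_int i + 1" "of_int j \<le> Im z / \<delta>" "Im z / \<delta> \<le> of_int j + 1"
      unfolding i_def j_def by linarith+
    then have zQ: "z \<in> Q i j" unfolding Q_iff using \<delta>(1) by (simp add: field_simps)
    then have ij: "(i, j) \<in> S" using z by (auto simp: S_def)
    \<comment> \<open>The centre of the square: moving from z towards c enters the open square at
      once, so \<zeta> tends to z through points where \<open>H_box\<close> applies.\<close>
    define c where "c = v i j + Complex (\<delta> / 2) (\<delta> / 2)"
    have c: "c \<in> interior (Q i j)"
      using \<delta>(1) by (simp add: Q_def c_def v_def in_box_complex_iff algebra_simps)
    define \<zeta> where "\<zeta> = (\<lambda>t. z - t *\<^sub>R (z - c))"
    have "eventually (\<lambda>t. t \<in> {0<..<1}) (at_right (0::real))"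
      by (rule eventually_at_right_real) simp
    then have ev: "eventually (\<lambda>t. H (\<zeta> t) = 2 * of_real pi * \<i> * g (\<zeta> t)) (at_right 0)"
    proof eventually_elim
      case (elim t)
      then have "\<zeta> t \<in> interior (Q i j)" unfolding \<zeta>_def
        using mem_interior_convex_shrink[OF convQ c zQ, of t] by simp
      then show ?case using H_box[OF ij] by (simp add: Q_def)
    qed
    have \<zeta>: "(\<zeta> \<longlongrightarrow> z) (at_right 0)"
    proof -
      have "(\<zeta> \<longlongrightarrow> z - 0 *\<^sub>R (z - c)) (at_right 0)" unfolding \<zeta>_def by (intro tendsto_intros)
      then show ?thesis by simp
    qed
    have "isCont H z" unfolding H_def
      by (intro continuous_add continuous_diff continuous_sum B_cont L_cont z) simp_all
    then have "((\<lambda>t. H (\<zeta> t)) \<longlongrightarrow> H z) (at_right 0)" using \<zeta> by (rule isCont_tendsto_compose)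
    moreover have "isCont g z"
      using assms z K(2) holomorphic_on_imp_continuous_on continuous_on_eq_continuous_at by blast
    then have "((\<lambda>t. 2 * of_real pi * \<i> * g (\<zeta> t)) \<longlongrightarrow> 2 * of_real pi * \<i> * g z) (at_right 0)"
      using \<zeta> by (intro tendsto_intros isCont_tendsto_compose[of z g])
    then have "((\<lambda>t. H (\<zeta> t)) \<longlongrightarrow> 2 * of_real pi * \<i> * g z) (at_right 0)"
      using ev by (simp add: tendsto_cong)
    ultimately have "H z = 2 * of_real pi * \<i> * g z"
      by (rule tendsto_unique[rotated]) simp
    then show ?thesis by simp
  qed
  then show ?thesis
    using rational_limit_cong[OF _ rational_limit_cmult[OF lim_H, of "1 / (2 * of_real pi * \<i>)"], of g] by (simp add: K_def)
qed

section \<open>Linear algebra of Pade approximants\<close>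

lemma fps_mult_cong_upto:
  fixes F G H :: "'a::comm_ring_1 fps"
  assumes "\<And>v. v \<le> N \<Longrightarrow> fps_nth F v = fps_nth G v" "v \<le> N"
  shows "fps_nth (F * H) v = fps_nth (G * H) v"
  unfolding fps_mult_nth using assms by (intro sum.cong) auto

text \<open>Extending the coefficients by 0 to negative indices, as in the Hankel matrix, makes the
  range of summation independent of n.\<close>

lemma fps_nth_mult_poly:
  assumes "degree Q \<le> q"
  shows "fps_nth (A * fps_of_poly Q) n = (\<Sum>j\<le>q. poly.coeff Q j * fps_nth_int A (int n - int j))"
proof -
  have "fps_nth (A * fps_of_poly Q) n = (\<Sum>j\<le>n. poly.coeff Q j * fps_nth A (n - j))"
    by (simp add: mult.commute[of A] fps_mult_nth atLeast0AtMost)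
  also have "\<dots> = (\<Sum>j\<le>n. poly.coeff Q j * fps_nth_int A (int n - int j))"
    by (intro sum.cong) (auto simp: fps_nth_int_def nat_diff_distrib)
  also have "\<dots> = (\<Sum>j\<le>max n q. poly.coeff Q j * fps_nth_int A (int n - int j))"
    by (intro sum.mono_neutral_left) (auto simp: fps_nth_int_def)
  also have "\<dots> = (\<Sum>j\<le>q. poly.coeff Q j * fps_nth_int A (int n - int j))"
    using assms by (intro sum.mono_neutral_right) (auto intro: coeff_eq_0)
  finally show ?thesis .
qed

section \<open>The Hankel system and its solution by Cramer's rule\<close>

definition hankel_mat :: "complex fps \<Rightarrow> nat \<Rightarrow> nat \<Rightarrow> complex Matrix.mat" where
  "hankel_mat A p q = Matrix.mat q q
     (\<lambda>(i, j). fps_nth_int A (int p - int q + int (Suc i) + int (Suc j) - 1))"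

lemma hankel_mat_carrier [simp]: "hankel_mat A p q \<in> carrier_mat q q"
  by (simp add: hankel_mat_def)

text \<open>
  With this ordering, the vanishing of the coefficients \<open>p + 1, \<dots>, p + q\<close> of \<open>A Q\<close> becomes a
  linear system whose matrix is exactly the Hankel matrix. The index \<open>0\<close> (the normalized
  coefficient of \<open>Q\<close>) is left out.
\<close>

definition rev_coeffs :: "nat \<Rightarrow> complex poly \<Rightarrow> complex Matrix.vec" where
  "rev_coeffs q Q = Matrix.vec q (\<lambda>j. poly.coeff Q (q - j))"

text \<open>With indices from 0, the entry (i, j) carries the Taylor index p - q + i + j + 1 and
  meets the coefficient q - j of Q; the two add up to p + 1 + i. The subtracted term belongs to the
  coefficient 0, which the vector omits.\<close>

lemma hankel_mat_mult_rev_coeffs: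
  assumes "degree Q \<le> q" "i < q"
  shows "vec_index (hankel_mat A p q *\<^sub>v rev_coeffs q Q) i
    = fps_nth (A * fps_of_poly Q) (p + 1 + i) - poly.coeff Q 0 * fps_nth A (p + 1 + i)"
proof -
  define f where "f = (\<lambda>j. poly.coeff Q j * fps_nth_int A (int (p + 1 + i) - int j))"
  have "vec_index (hankel_mat A p q *\<^sub>v rev_coeffs q Q) i = (\<Sum>j<q. f (Suc (q - Suc j)))"
    using assms(2)
    by (auto simp: hankel_mat_def rev_coeffs_def scalar_prod_def f_def atLeast0LessThan Suc_diff_Suc
        of_nat_diff mult.commute intro!: sum.cong arg_cong2[of _ _ _ _ "(*)"] arg_cong[of _ _ "fps_nth_int A"])
  also have "\<dots> = (\<Sum>j<q. f (Suc j))" by (rule sum.nat_diff_reindex)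
  also have "\<dots> = (\<Sum>j\<le>q. f j) - f 0" by (simp add: sum.atMost_shift)
  also have "(\<Sum>j\<le>q. f j) = fps_nth (A * fps_of_poly Q) (p + 1 + i)"
    by (simp only: fps_nth_mult_poly[OF assms(1)] f_def)
  also have "f 0 = poly.coeff Q 0 * fps_nth A (p + 1 + i)"
    by (simp add: f_def fps_nth_int_def nat_add_distrib)
  finally show ?thesis .
qed

text \<open>With the adjugate, every entry is a polynomial in the Taylor coefficients divided by the
  determinant, from which continuity can be read off. The minus sign comes from moving the
  normalized coefficient of the denominator to the right-hand side. For determinant 0, division by 0
  yields the zero vector.\<close>

definition pade_vec :: "complex fps \<Rightarrow> nat \<Rightarrow> nat \<Rightarrow> complex Matrix.vec" where
  "pade_vec A p q = (- 1 / hankel_det A p q) \<cdot>\<^sub>v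
     (adj_mat (hankel_mat A p q) *\<^sub>v Matrix.vec q (\<lambda>i. fps_nth A (p + 1 + i)))"

definition pade_den :: "complex fps \<Rightarrow> nat \<Rightarrow> nat \<Rightarrow> complex poly" where
  "pade_den A p q = 1 + (\<Sum>j<q. monom (vec_index (pade_vec A p q) j) (q - j))"

text \<open>Truncation makes the orders up to p agree by construction; the linear system is
  responsible for the orders p + 1 to p + q.\<close>

definition pade_num :: "complex fps \<Rightarrow> nat \<Rightarrow> nat \<Rightarrow> complex poly" where
  "pade_num A p q = truncate_fps (Suc p) (A * fps_of_poly (pade_den A p q))"

lemma coeff_pade_den:
  "poly.coeff (pade_den A p q) k =
     (if k = 0 then 1 else if k \<le> q then vec_index (pade_vec A p q) (q - k) else 0)"
proof -
  have "poly.coeff (pade_den A p q) k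
      = (if k = 0 then 1 else 0) + (\<Sum>j<q. if j = q - k \<and> k \<le> q then vec_index (pade_vec A p q) j else 0)"
    unfolding pade_den_def by (auto simp: coeff_sum intro!: sum.cong)
  also have "\<dots> = (if k = 0 then 1 else if k \<le> q then vec_index (pade_vec A p q) (q - k) else 0)"
    by (cases "k \<le> q") auto
  finally show ?thesis .
qed

lemma degree_pade_den: "degree (pade_den A p q) \<le> q"
  by (rule degree_le) (simp add: coeff_pade_den)

lemma degree_pade_num: "degree (pade_num A p q) \<le> p"
  by (rule degree_le) (simp add: pade_num_def)

lemma hankel_mat_mult_pade_vec:
  assumes "hankel_det A p q \<noteq> 0"
  shows "hankel_mat A p q *\<^sub>v pade_vec A p q = - Matrix.vec q (\<lambda>i. fps_nth A (p + 1 + i))"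
proof -
  define M where "M = hankel_mat A p q"
  define b where "b = Matrix.vec q (\<lambda>i. fps_nth A (p + 1 + i))"
  have M: "M \<in> carrier_mat q q" and b: "b \<in> carrier_vec q" by (simp_all add: M_def b_def)
  have det: "Determinant.det M = hankel_det A p q" by (simp add: M_def hankel_mat_def hankel_det_def)
  have "M *\<^sub>v pade_vec A p q = (- 1 / Determinant.det M) \<cdot>\<^sub>v (M *\<^sub>v (adj_mat M *\<^sub>v b))"
    unfolding pade_vec_def det M_def[symmetric] b_def[symmetric]
    using M b adj_mat(1)[OF M] by (intro mult_mat_vec) auto
  also have "M *\<^sub>v (adj_mat M *\<^sub>v b) = (M * adj_mat M) *\<^sub>v b"
    using M b adj_mat(1)[OF M] by simp
  also have "\<dots> = Determinant.det M \<cdot>\<^sub>v b"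
    unfolding adj_mat(2)[OF M] using b by (intro eq_vecI) (auto simp: row_smult)
  also have "(- 1 / Determinant.det M) \<cdot>\<^sub>v \<dots> = - b"
    using assms det by (intro eq_vecI) (auto simp: b_def)
  finally show ?thesis by (simp add: M_def b_def)
qed


lemma fps_nth_mult_pade_den:
  assumes "hankel_det A p q \<noteq> 0" "v \<le> p + q"
  shows "fps_nth (A * fps_of_poly (pade_den A p q)) v = poly.coeff (pade_num A p q) v"
proof (cases "v \<le> p")
  case False
  define i where "i = v - (p + 1)"
  have i: "i < q" "v = p + 1 + i" using False assms(2) by (auto simp: i_def)
  have "rev_coeffs q (pade_den A p q) = pade_vec A p q"
    by (intro eq_vecI) (auto simp: rev_coeffs_def coeff_pade_den pade_vec_def hankel_mat_def adj_mat_def)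
  then have "fps_nth (A * fps_of_poly (pade_den A p q)) v = 0"
    using hankel_mat_mult_rev_coeffs[OF degree_pade_den[of A p q] i(1), of A p] hankel_mat_mult_pade_vec[OF assms(1)] i
    by (simp add: coeff_pade_den)
  then show ?thesis using False by (simp add: pade_num_def)
qed (simp add: pade_num_def)

text \<open>The difference of two candidates has constant coefficient 0, so it solves the
  homogeneous system, whose matrix is invertible.\<close>

lemma pade_den_unique:
  assumes det: "hankel_det A p q \<noteq> 0" and Q: "degree Q \<le> q" "poly.coeff Q 0 = 1"
    and zero: "\<And>v. p < v \<Longrightarrow> v \<le> p + q \<Longrightarrow> fps_nth (A * fps_of_poly Q) v = 0"
  shows "Q = pade_den A p q"
proof -
  define D where "D = Q - pade_den A p q"
  have D: "degree D \<le> q" "poly.coeff D 0 = 0"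
    using Q degree_pade_den[of A p q] by (auto simp: D_def coeff_pade_den intro: degree_diff_le)
  have "hankel_mat A p q *\<^sub>v rev_coeffs q D = 0\<^sub>v q"
  proof (intro eq_vecI)
    fix i assume "i < dim_vec (0\<^sub>v q :: complex Matrix.vec)"
    then have i: "i < q" by simp
    have "fps_nth (A * fps_of_poly (pade_den A p q)) (p + 1 + i) = 0"
      using fps_nth_mult_pade_den[OF det, of "p + 1 + i"] i degree_pade_num[of A p q] by (simp add: coeff_eq_0)
    moreover have "fps_nth (A * fps_of_poly Q) (p + 1 + i) = 0" using i by (intro zero) auto
    ultimately show "vec_index (hankel_mat A p q *\<^sub>v rev_coeffs q D) i = vec_index (0\<^sub>v q) i"
      using hankel_mat_mult_rev_coeffs[OF D(1) i, of A p] i D(2)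
      by (simp add: D_def fps_of_poly_diff right_diff_distrib)
  qed (simp add: hankel_mat_def)
  moreover have "Determinant.det (hankel_mat A p q) \<noteq> 0" using det by (simp add: hankel_det_def hankel_mat_def)
  ultimately have 0: "rev_coeffs q D = 0\<^sub>v q"
    using det_0_iff_vec_prod_zero[OF hankel_mat_carrier[of A p q]] rev_coeffs_def vec_carrier by metis
  have "poly.coeff D k = 0" for k
  proof (cases "k = 0 \<or> k > q")
    case False
    then have "poly.coeff D k = vec_index (rev_coeffs q D) (q - k)" by (simp add: rev_coeffs_def)
    then show ?thesis using 0 False by simp
  qed (use D in \<open>auto intro: coeff_eq_0\<close>)
  then have "D = 0" by (simp add: poly_eq_iff)
  then show ?thesis by (simp add: D_def)
qed

text \<open>Multiplying by Q or by its inverse preserves agreement up to order N, since a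
  coefficient of a product depends only on coefficients of the same or lower order. This passes
  between the quotients in \<open>is_pade\<close> and the products in the linear system.\<close>

lemma fps_divide_poly_cong_iff:
  assumes "poly.coeff Q 0 = (1::complex)"
  shows "(\<forall>v\<le>N. fps_nth (fps_of_poly P / fps_of_poly Q) v = fps_nth A v)
     \<longleftrightarrow> (\<forall>v\<le>N. fps_nth (A * fps_of_poly Q) v = poly.coeff P v)"
proof -
  define I where "I = inverse (fps_of_poly Q)"
  have I: "fps_of_poly Q * I = 1" "fps_of_poly P / fps_of_poly Q = fps_of_poly P * I"
    unfolding I_def using assms inverse_mult_eq_1[of "fps_of_poly Q"]
    by (simp_all add: mult.commute fps_divide_unit)
  show ?thesis
  proof
    assume "\<forall>v\<le>N. fps_nth (fps_of_poly P / fps_of_poly Q) v = fps_nth A v"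
    then have "fps_nth (A * fps_of_poly Q) v = fps_nth (fps_of_poly P * I * fps_of_poly Q) v" if "v \<le> N" for v
      using that unfolding I(2) by (intro fps_mult_cong_upto[of N]) auto
    then show "\<forall>v\<le>N. fps_nth (A * fps_of_poly Q) v = poly.coeff P v"
      using I(1) by (simp add: mult.assoc mult.commute[of I])
  next
    assume "\<forall>v\<le>N. fps_nth (A * fps_of_poly Q) v = poly.coeff P v"
    then have "fps_nth (fps_of_poly P * I) v = fps_nth (A * fps_of_poly Q * I) v" if "v \<le> N" for v
      using that by (intro fps_mult_cong_upto[of N]) auto
    then show "\<forall>v\<le>N. fps_nth (fps_of_poly P / fps_of_poly Q) v = fps_nth A v"
      unfolding I(2) using I(1) by (simp add: mult.assoc)
  qed
qed

section \<open>Lowest terms and values of the approximant\<close>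

lemma pade_eqI: "is_pade A p q R \<Longrightarrow> pade A p q = R"
  unfolding pade_def by (blast intro: is_pade_unique)

lemma pade_eq_Fract:
  assumes "hankel_det A p q \<noteq> 0"
  shows "pade A p q = Fraction_Field.Fract (pade_num A p q) (pade_den A p q)"
proof (rule pade_eqI)
  have "poly.coeff (pade_den A p q) 0 = 1" by (simp add: coeff_pade_den)
  then show "is_pade A p q (Fraction_Field.Fract (pade_num A p q) (pade_den A p q))"
    using degree_pade_num[of A p q] degree_pade_den[of A p q] fps_nth_mult_pade_den[OF assms]
      fps_divide_poly_cong_iff[of "pade_den A p q" "p + q" "pade_num A p q" A]
    unfolding is_pade_def by blast
qed

text \<open>
  Cancelling a common factor would give a second solution of the same linear system, of smaller
  degree.
\<close>

lemma coprime_pade: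
  assumes det: "hankel_det A p q \<noteq> 0"
  shows "coprime (pade_num A p q) (pade_den A p q)"
proof -
  define P Q where "P = pade_num A p q" and "Q = pade_den A p q"
  define g where "g = gcd P Q"
  obtain P' Q' where PQ: "P = g * P'" "Q = g * Q'" unfolding g_def by (meson dvdE gcd_dvd1 gcd_dvd2)
  have Q0: "poly.coeff Q 0 = 1" by (simp add: Q_def coeff_pade_den)
  then have g0: "poly.coeff g 0 * poly.coeff Q' 0 = 1" by (simp add: PQ coeff_mult)
  then have nz: "poly.coeff g 0 \<noteq> 0" "poly.coeff Q' 0 \<noteq> 0" by auto
  \<comment> \<open>The common factor has nonzero constant coefficient because Q has, so it can be
    cancelled among power series.\<close>
  define I where "I = inverse (fps_of_poly g)"
  have I: "fps_of_poly g * I = 1"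
    unfolding I_def using nz inverse_mult_eq_1[of "fps_of_poly g"] by (simp add: mult.commute)
  \<comment> \<open>Restores the constant coefficient 1 after cancellation.\<close>
  define c where "c = 1 / poly.coeff Q' 0"
  have nz': "g \<noteq> 0" "Q' \<noteq> 0" "c \<noteq> 0" using nz by (auto simp: c_def)
  have deg: "degree P \<le> p" "degree Q \<le> q" by (simp_all add: P_def Q_def degree_pade_num degree_pade_den)
  have degQ: "degree Q = degree g + degree Q'" using nz' by (simp add: PQ degree_mult_eq)
  have degP: "degree P' \<le> p"
    using deg(1) nz' by (cases "P' = 0") (auto simp: PQ degree_mult_eq)
  have "Polynomial.smult c Q' = Q" unfolding Q_def
  proof (rule pade_den_unique[OF det])
    show "degree (Polynomial.smult c Q') \<le> q" using degQ deg(2) nz' by simp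
    show "poly.coeff (Polynomial.smult c Q') 0 = 1" using nz by (simp add: c_def)
    fix v assume v: "p < v" "v \<le> p + q"
    have eq: "A * fps_of_poly (Polynomial.smult c Q') = A * fps_of_poly Q * (fps_const c * I)"
      using I by (simp add: PQ fps_of_poly_mult fps_of_poly_smult ac_simps)
    have "fps_nth (A * fps_of_poly (Polynomial.smult c Q')) v = fps_nth (fps_of_poly P * (fps_const c * I)) v"
      unfolding eq using v fps_nth_mult_pade_den[OF det] by (intro fps_mult_cong_upto[of "p + q"]) (auto simp: P_def Q_def)
    also have "fps_of_poly P * (fps_const c * I) = fps_of_poly (Polynomial.smult c P')"
      using I by (simp add: PQ fps_of_poly_mult fps_of_poly_smult ac_simps)
    also have "fps_nth \<dots> v = 0" using degP v by (simp add: coeff_eq_0)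
    finally show "fps_nth (A * fps_of_poly (Polynomial.smult c Q')) v = 0" .
  qed
  \<comment> \<open>By uniqueness the cancellation has not lowered the degree, so g is
    constant.\<close>
  then have "degree Q = degree Q'" using nz' by (metis degree_smult_eq)
  then have "degree g = 0" using degQ by simp
  then have "is_unit g" using nz'(1) by (simp add: is_unit_iff_degree)
  then show ?thesis unfolding P_def Q_def g_def by (simp add: is_unit_gcd_iff coprime_iff_gcd_eq_1)
qed

text \<open>Normalizing a coprime pair only divides by a nonzero constant, which cancels in the
  quotient; the zeros of Q are therefore genuine poles.\<close>

lemma fract_eval_Fract:
  assumes "coprime P Q" "Q \<noteq> 0"
  shows "fract_eval (Fraction_Field.Fract P Q) w = (if poly Q w = 0 then None else Some (poly P w / poly Q w))"
proof -
  obtain a b where ab: "normalize_quot (P, Q) = (a, b)" by (cases "normalize_quot (P, Q)")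
  then have quot: "quot_of_fract (Fraction_Field.Fract P Q) = (a, b)"
    using quot_of_fract_quot_to_fract[of "(P, Q)"] by (simp add: quot_to_fract_def)
  obtain d where d: "P = a * d" "Q = b * d" "d dvd P" "d dvd Q"
    using normalize_quotE[OF assms(2), of P] unfolding ab fst_conv snd_conv by blast
  then have "is_unit d" using assms(1) coprime_common_divisor by blast
  then obtain c where "d = [:c:]" "c \<noteq> 0" by (metis is_unit_polyE is_unit_iff_degree degree_eq_zeroE pCons_eq_0_iff not_is_unit_0)
  then show ?thesis unfolding fract_eval_def quot using d by simp
qed

text \<open>A kernel vector yields D of degree at most q with D(0) = 0, and N of degree at most p,
  such that (P / Q) D and N agree up to order p + q. Clearing the denominator gives P D = N Q, and
  coprimality gives D = Q E, N = P E. As deg P = p, E is constant; D(0) = 0 and Q(0) = 1 then force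
  E = 0, a contradiction.\<close>

lemma hankel_det_rational_nonzero:
  assumes "coprime P Q" "poly.coeff Q 0 = 1" "P \<noteq> 0" "degree P = p" "degree Q \<le> q"
  shows "hankel_det (fps_of_poly P / fps_of_poly Q) p q \<noteq> 0"
proof
  define A where "A = fps_of_poly P / fps_of_poly Q"
  assume "hankel_det (fps_of_poly P / fps_of_poly Q) p q = 0"
  then have "Determinant.det (hankel_mat A p q) = 0" by (simp add: hankel_det_def hankel_mat_def A_def)
  then obtain x where x: "x \<in> carrier_vec q" "x \<noteq> 0\<^sub>v q" "hankel_mat A p q *\<^sub>v x = 0\<^sub>v q"
    using det_0_iff_vec_prod_zero[OF hankel_mat_carrier] by blast
  define D where "D = (\<Sum>j<q. monom (vec_index x j) (q - j))"
  have coeff_D: "poly.coeff D k = (if k = 0 \<or> k > q then 0 else vec_index x (q - k))" for k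
  proof -
    have "poly.coeff D k = (\<Sum>j<q. if j = q - k \<and> k \<le> q then vec_index x j else 0)"
      unfolding D_def by (auto simp: coeff_sum intro!: sum.cong)
    also have "\<dots> = (if k = 0 \<or> k > q then 0 else vec_index x (q - k))" by (cases "k \<le> q") auto
    finally show ?thesis .
  qed
  have degD: "degree D \<le> q" by (rule degree_le) (simp add: coeff_D)
  have revD: "rev_coeffs q D = x" using x(1) by (intro eq_vecI) (auto simp: rev_coeffs_def coeff_D)
  define N where "N = truncate_fps (Suc p) (A * fps_of_poly D)"
  have degN: "degree N \<le> p" by (rule degree_le) (simp add: N_def)
  have nth: "fps_nth (A * fps_of_poly D) v = fps_nth (fps_of_poly N) v" if "v \<le> p + q" for v
  proof (cases "v \<le> p")
    case False
    define i where "i = v - (p + 1)"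
    have i: "i < q" "v = p + 1 + i" using False that by (auto simp: i_def)
    show ?thesis
      using hankel_mat_mult_rev_coeffs[OF degD i(1), of A p] x(3) i revD False by (simp add: coeff_D N_def)
  qed (simp add: N_def)
  have AQ: "A * fps_of_poly Q = fps_of_poly P"
    using assms(2) by (simp add: A_def unit_imp_dvd)
  \<comment> \<open>Both products have degree at most p + q, so agreement up to that order is
    already equality.\<close>
  have "poly.coeff (P * D) v = poly.coeff (N * Q) v" for v
  proof (cases "v \<le> p + q")
    case True
    have "poly.coeff (P * D) v = fps_nth (fps_of_poly (P * D)) v" by simp
    also have "\<dots> = fps_nth (A * fps_of_poly D * fps_of_poly Q) v"
      by (simp only: fps_of_poly_mult AQ[symmetric] mult_ac)
    also have "\<dots> = fps_nth (fps_of_poly N * fps_of_poly Q) v"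
      using True nth by (rule fps_mult_cong_upto[rotated])
    also have "\<dots> = poly.coeff (N * Q) v" by (simp only: fps_of_poly_mult[symmetric] fps_of_poly_nth)
    finally show ?thesis .
  next
    case False
    then have "degree (P * D) < v" "degree (N * Q) < v"
      using degree_mult_le[of P D] degree_mult_le[of N Q] assms degD degN by linarith+
    then show ?thesis by (simp add: coeff_eq_0)
  qed
  then have PD: "P * D = N * Q" by (simp add: poly_eq_iff)
  have "Q \<noteq> 0" using assms(2) by auto
  have "Q dvd P * D" by (simp add: PD)
  then have "Q dvd D" using assms(1) by (simp add: coprime_commute coprime_dvd_mult_right_iff)
  then obtain E where E: "D = Q * E" by blast
  then have "N = P * E" using PD \<open>Q \<noteq> 0\<close> by (metis mult.assoc mult.commute mult_right_cancel)
  moreover have "D \<noteq> 0" using x(1,2) revD by (auto simp: rev_coeffs_def)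
  ultimately have "degree E = 0" using degN assms(3,4) E by (cases "E = 0") (auto simp: degree_mult_eq)
  moreover have "poly.coeff E 0 = 0" using assms(2) coeff_D[of 0] by (simp add: E coeff_mult)
  ultimately have "E = 0" by (metis leading_coeff_0_iff)
  with E \<open>D \<noteq> 0\<close> show False by simp
qed

section \<open>Baire category in the space of holomorphic functions\<close>

text \<open>On compact nonempty K the distance attains a maximum below e, and the slack that remains
  is a radius around g.\<close>

lemma openin_hol_basic:
  assumes "f \<in> hol_space \<Omega>" "compact K" "K \<subseteq> \<Omega>"
  shows "openin (hol_topology \<Omega>) {g \<in> hol_space \<Omega>. \<forall>z\<in>K. dist (f z) (g z) < e}"
  unfolding openin_hol_topology
proof (intro conjI ballI)
  fix g assume g: "g \<in> {g \<in> hol_space \<Omega>. \<forall>z\<in>K. dist (f z) (g z) < e}"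
  have "continuous_on K f" "continuous_on K g"
    using assms g by (auto simp: hol_space_def intro!: continuous_on_subset[of \<Omega>] holomorphic_on_imp_continuous_on)
  then have cont: "continuous_on K (\<lambda>z. dist (f z) (g z))" by (intro continuous_intros)
  obtain d where d: "d > 0" "\<And>z. z \<in> K \<Longrightarrow> dist (f z) (g z) \<le> e - d"
  proof (cases "K = {}")
    case False
    then obtain z0 where z0: "z0 \<in> K" "\<And>z. z \<in> K \<Longrightarrow> dist (f z) (g z) \<le> dist (f z0) (g z0)"
      using continuous_attains_sup[OF assms(2) False cont] by blast
    show ?thesis by (rule that[of "e - dist (f z0) (g z0)"]) (use g z0 in auto)
  qed (use that[of 1] in auto)
  have "{h \<in> hol_space \<Omega>. \<forall>z\<in>K. dist (g z) (h z) < d} \<subseteq> {g \<in> hol_space \<Omega>. \<forall>z\<in>K. dist (f z) (g z) < e}"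
  proof safe
    fix h z assume h: "\<forall>z\<in>K. dist (g z) (h z) < d" "z \<in> K"
    then show "dist (f z) (h z) < e"
      using dist_triangle[of "f z" "h z" "g z"] d(2)[of z] by fastforce
  qed
  then show "\<exists>K' e'. compact K' \<and> K' \<subseteq> \<Omega> \<and> 0 < e' \<and>
      {h \<in> hol_space \<Omega>. \<forall>z\<in>K'. dist (g z) (h z) < e'} \<subseteq> {g \<in> hol_space \<Omega>. \<forall>z\<in>K. dist (f z) (g z) < e}"
    using assms(2,3) d(1) by blast
qed auto

lemma hol_dense_iff:
  assumes "S \<subseteq> hol_space \<Omega>"
  shows "hol_topology \<Omega> closure_of S = hol_space \<Omega> \<longleftrightarrow>
    (\<forall>f\<in>hol_space \<Omega>. \<forall>K e. compact K \<longrightarrow> K \<subseteq> \<Omega> \<longrightarrow> e > 0 \<longrightarrow> (\<exists>g\<in>S. \<forall>z\<in>K. dist (f z) (g z) < e))"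
    (is "_ \<longleftrightarrow> ?R")
proof -
  have "(\<forall>T. openin (hol_topology \<Omega>) T \<and> T \<noteq> {} \<longrightarrow> S \<inter> T \<noteq> {}) \<longleftrightarrow> ?R"
  proof (intro iffI ballI allI impI)
    fix f K and e :: real
    assume *: "\<forall>T. openin (hol_topology \<Omega>) T \<and> T \<noteq> {} \<longrightarrow> S \<inter> T \<noteq> {}"
      "f \<in> hol_space \<Omega>" "compact K" "K \<subseteq> \<Omega>" "e > 0"
    define T where "T = {g \<in> hol_space \<Omega>. \<forall>z\<in>K. dist (f z) (g z) < e}"
    have "f \<in> T" using *(2,5) by (simp add: T_def)
    moreover have "openin (hol_topology \<Omega>) T" unfolding T_def by (rule openin_hol_basic[OF *(2-4)])
    ultimately have "S \<inter> T \<noteq> {}" using *(1)[rule_format, of T] by blast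
    then show "\<exists>g\<in>S. \<forall>z\<in>K. dist (f z) (g z) < e" unfolding T_def by blast
  next
    fix T assume R: ?R and T: "openin (hol_topology \<Omega>) T \<and> T \<noteq> {}"
    then obtain f where f: "f \<in> T" by blast
    then obtain K e where K: "compact K" "K \<subseteq> \<Omega>" "e > 0"
      "{g \<in> hol_space \<Omega>. \<forall>z\<in>K. dist (f z) (g z) < e} \<subseteq> T" and "f \<in> hol_space \<Omega>"
      using T unfolding openin_hol_topology by blast
    then obtain g where "g \<in> S" "\<forall>z\<in>K. dist (f z) (g z) < e" using R by blast
    with K assms show "S \<inter> T \<noteq> {}" by blast
  qed
  then show ?thesis using dense_intersects_open[of "hol_topology \<Omega>" S] by simp
qed

text \<open>The nested-ball argument, with closeness e on the k-th exhaustion set in place of a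
  metric ball. Along the sequence k grows and e is at least halved, so the centres converge
  uniformly on compact sets and the limit is holomorphic.\<close>

lemma hol_topology_Baire:
  assumes "open \<Omega>" "\<And>n. openin (hol_topology \<Omega>) (U n)"
    "\<And>n::nat. hol_topology \<Omega> closure_of U n = hol_space \<Omega>"
  shows "hol_topology \<Omega> closure_of (\<Inter>n. U n) = hol_space \<Omega>"
proof -
  define N where "N = (\<lambda>(f, k, e). {g \<in> hol_space \<Omega>. \<forall>z\<in>exhaustion \<Omega> k. dist (f z) (g z) < e})"
  have Uhol: "U n \<subseteq> hol_space \<Omega>" for n using openin_subset[OF assms(2)] by simp
  have inner: "\<exists>f' k' e'. f' \<in> hol_space \<Omega> \<and> k < k' \<and> 0 < e' \<and> e' \<le> e / 2 \<and> N (f', k', e') \<subseteq> W \<inter> U n"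
    if W: "openin (hol_topology \<Omega>) W" "W \<noteq> {}" and "e > 0" for W n k and e :: real
  proof -
    have "U n \<inter> W \<noteq> {}"
      using dense_intersects_open[of "hol_topology \<Omega>" "U n"] assms(3) W by simp
    then obtain g where g: "g \<in> U n" "g \<in> W" by blast
    have "openin (hol_topology \<Omega>) (U n \<inter> W)" using W assms(2) by blast
    then obtain K d where K: "compact K" "K \<subseteq> \<Omega>" "d > 0"
      "{h \<in> hol_space \<Omega>. \<forall>z\<in>K. dist (g z) (h z) < d} \<subseteq> U n \<inter> W"
      using g unfolding openin_hol_topology by blast
    obtain j where j: "K \<subseteq> exhaustion \<Omega> j" using compact_subset_exhaustion[OF assms(1) K(1,2)] by blast
    have "K \<subseteq> exhaustion \<Omega> (max j (Suc k))" using j exhaustion_mono[of j "max j (Suc k)" \<Omega>] by simp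
    then have "N (g, max j (Suc k), min d (e / 2)) \<subseteq> {h \<in> hol_space \<Omega>. \<forall>z\<in>K. dist (g z) (h z) < d}"
      by (auto simp: N_def)
    then show ?thesis
      using K(3,4) g(1) Uhol \<open>e > 0\<close>
      by (intro exI[of _ g] exI[of _ "max j (Suc k)"] exI[of _ "min d (e / 2)"]) auto
  qed
  have "\<exists>g\<in>\<Inter>n. U n. g \<in> T" if T: "openin (hol_topology \<Omega>) T" "T \<noteq> {}" for T
  proof -
    define P where "P = (\<lambda>n (f, k, e). f \<in> hol_space \<Omega> \<and> (e::real) > 0 \<and> N (f, k, e) \<subseteq> U n \<inter> T)"
    \<comment> \<open>The next neighbourhood lies in the one of half the radius. The limit then
      inherits the non-strict bound e / 2, hence the strict bound e, and so stays in every
      neighbourhood of the sequence.\<close>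
    define R where "R = (\<lambda>(n::nat) (f, k, e) (f', k', e'). k < k' \<and> (e'::real) \<le> e / 2 \<and> N (f', k', e') \<subseteq> N (f, k, e / 2))"
    have "\<exists>x. \<forall>n. P n (x n) \<and> R n (x n) (x (Suc n))"
    proof (rule dependent_nat_choice)
      show "\<exists>x. P 0 x" using inner[OF T, of 1 0 0] by (force simp: P_def)
      fix x n assume P: "P n x"
      obtain f k e where x: "x = (f, k, e)" by (cases x)
      have f: "f \<in> hol_space \<Omega>" "e > 0" "N (f, k, e) \<subseteq> U n \<inter> T" using P by (auto simp: P_def x)
      have "openin (hol_topology \<Omega>) (N (f, k, e / 2))"
        unfolding N_def prod.case by (rule openin_hol_basic[OF f(1) compact_exhaustion exhaustion_subset])
      moreover have "f \<in> N (f, k, e / 2)" using f by (simp add: N_def)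
      ultimately obtain f' k' e' where y: "f' \<in> hol_space \<Omega>" "k < k'" "0 < e'" "e' \<le> e / 2"
        "N (f', k', e') \<subseteq> N (f, k, e / 2) \<inter> U (Suc n)"
        using inner[of "N (f, k, e / 2)" e k "Suc n"] f(2) by (metis empty_iff)
      have "N (f, k, e / 2) \<subseteq> N (f, k, e)" using f(2) by (force simp: N_def)
      then show "\<exists>y. P (Suc n) y \<and> R n x y"
        using y f by (intro exI[of _ "(f', k', e')"]) (auto simp: P_def R_def x)
    qed
    then obtain x where x: "\<And>n. P n (x n)" "\<And>n. R n (x n) (x (Suc n))" by blast
    define f k e where "f = (\<lambda>n. fst (x n))" and "k = (\<lambda>n. fst (snd (x n)))" and "e = (\<lambda>n. snd (snd (x n)))"
    have xe: "x n = (f n, k n, e n)" for n by (simp add: f_def k_def e_def)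
    have fh: "f n \<in> hol_space \<Omega>" and e0: "e n > 0" and NU: "N (x n) \<subseteq> U n \<inter> T" for n
      using x(1)[of n] by (auto simp: P_def xe)
    have ks: "k n < k (Suc n)" and es: "e (Suc n) \<le> e n / 2" and Ns: "N (x (Suc n)) \<subseteq> N (f n, k n, e n / 2)" for n
      using x(2)[of n] by (auto simp: R_def xe)
    \<comment> \<open>Thus every compact subset of \<Omega> is controlled from some index
      on.\<close>
    have kn: "n \<le> k n" for n using strict_mono_imp_increasing[of k n] ks by (simp add: strict_mono_Suc_iff)
    have en: "e n \<le> e 0 / 2 ^ n" for n
    proof (induction n)
      case (Suc n)
      then show ?case using es[of n] by simp
    qed simp
    have e_lim: "e \<longlonglongrightarrow> 0"
    proof (rule tendsto_sandwich[of "\<lambda>_. 0" e _ "\<lambda>n. e 0 * (1 / 2) ^ n"])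
      show "(\<lambda>n. e 0 * (1 / 2) ^ n) \<longlonglongrightarrow> 0"
        by (intro tendsto_mult_right_zero LIMSEQ_power_zero) simp
    qed (use e0 en in \<open>auto simp: less_imp_le power_divide\<close>)
    have N_mono: "N (x m) \<subseteq> N (x n)" if "n \<le> m" for m n
    proof (rule lift_Suc_antimono_le[OF _ that])
      fix i
      have "N (f i, k i, e i / 2) \<subseteq> N (x i)" using e0[of i] by (force simp: N_def xe)
      with Ns[of i] show "N (x (Suc i)) \<subseteq> N (x i)" by blast
    qed
    have near: "dist (f n z) (f m z) < e n / 2" if "n \<le> m" "z \<in> exhaustion \<Omega> (k n)" for n m z
    proof (cases "n = m")
      case True
      then show ?thesis using e0 by simp
    next
      case False
      have "f m \<in> N (x m)" using fh e0 by (simp add: N_def xe)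
      then have "f m \<in> N (f n, k n, e n / 2)" using N_mono[of "Suc n" m] Ns[of n] False that(1) by auto
      then show ?thesis using that(2) by (simp add: N_def)
    qed
    \<comment> \<open>The restriction makes the pointwise limit \<open>extensional\<close>, as
      \<open>hol_space\<close> demands.\<close>
    define g where "g = restrict (\<lambda>z. lim (\<lambda>n. f n z)) \<Omega>"
    have g_lim: "(\<lambda>n. f n z) \<longlonglongrightarrow> g z" if z: "z \<in> \<Omega>" for z
    proof -
      obtain j where j: "z \<in> exhaustion \<Omega> j" using compact_subset_exhaustion[OF assms(1), of "{z}"] z by auto
      have "Cauchy (\<lambda>n. f n z)"
      proof (rule metric_CauchyI)
        fix d :: real assume "d > 0"
        then have "eventually (\<lambda>n. e n < d \<and> n \<ge> j) sequentially"
          using e_lim by (intro eventually_conj order_tendstoD(2)[OF e_lim] eventually_ge_at_top)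
        then obtain n where n: "e n < d" "n \<ge> j" using eventually_happens'[OF sequentially_bot] by blast
        have z': "z \<in> exhaustion \<Omega> (k n)" using j exhaustion_mono[of j "k n" \<Omega>] kn[of n] n(2) by auto
        have "dist (f m z) (f l z) < d" if "m \<ge> n" "l \<ge> n" for m l
          using near[OF that(1) z'] near[OF that(2) z'] n(1) dist_triangle3[of "f m z" "f l z" "f n z"] by simp
        then show "\<exists>M. \<forall>m\<ge>M. \<forall>n\<ge>M. dist (f m z) (f n z) < d" by blast
      qed
      then have "convergent (\<lambda>n. f n z)" by (simp add: Cauchy_convergent)
      then show ?thesis using z by (simp add: g_def convergent_LIMSEQ_iff)
    qed
    have g_near: "dist (f n z) (g z) \<le> e n / 2" if z: "z \<in> exhaustion \<Omega> (k n)" for n z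
    proof (rule LIMSEQ_le_const2)
      have "z \<in> \<Omega>" using z exhaustion_subset by blast
      then show "(\<lambda>m. dist (f n z) (f m z)) \<longlonglongrightarrow> dist (f n z) (g z)" by (intro tendsto_intros g_lim)
      show "\<exists>M. \<forall>m\<ge>M. dist (f n z) (f m z) \<le> e n / 2" using near[OF _ z] by (intro exI[of _ n]) (auto simp: less_imp_le)
    qed
    have "g holomorphic_on \<Omega>"
    proof (rule holomorphic_uniform_sequence[OF assms(1)])
      show "f n holomorphic_on \<Omega>" for n using fh[of n] by (simp add: hol_space_def)
      fix z assume "z \<in> \<Omega>"
      then obtain d where d: "d > 0" "cball z d \<subseteq> \<Omega>" using assms(1) open_contains_cball by blast
      obtain j where j: "cball z d \<subseteq> exhaustion \<Omega> j"
        using compact_subset_exhaustion[OF assms(1) compact_cball d(2)] by blast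
      have "uniform_limit (cball z d) f g sequentially"
      proof (rule uniform_limitI)
        fix r :: real assume "r > 0"
        then have "eventually (\<lambda>n. e n < r \<and> n \<ge> j) sequentially"
          by (intro eventually_conj order_tendstoD(2)[OF e_lim] eventually_ge_at_top)
        then show "eventually (\<lambda>n. \<forall>w\<in>cball z d. dist (f n w) (g w) < r) sequentially"
        proof eventually_elim
          case (elim n)
          show ?case
          proof
            fix w assume "w \<in> cball z d"
            then have "w \<in> exhaustion \<Omega> (k n)" using j exhaustion_mono[of j "k n" \<Omega>] kn[of n] elim by auto
            then show "dist (f n w) (g w) < r" using g_near[of w n] elim e0[of n] by simp
          qed
        qed
      qed
      with d show "\<exists>d>0. cball z d \<subseteq> \<Omega> \<and> uniform_limit (cball z d) f g sequentially" by blast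
    qed
    then have "g \<in> hol_space \<Omega>" by (simp add: hol_space_def g_def)
    then have "g \<in> N (x n)" for n using g_near[of _ n] e0[of n] by (fastforce simp: N_def xe)
    then have "g \<in> U n \<inter> T" for n using NU by blast
    then show ?thesis by blast
  qed
  then show ?thesis
    using dense_intersects_open[of "hol_topology \<Omega>" "\<Inter>n. U n"] by simp blast
qed

section \<open>Continuity of Pade approximants\<close>

text \<open>The Leibniz formula is a finite sum of products of entries.\<close>

lemma tendsto_det:
  fixes A :: "'x \<Rightarrow> complex Matrix.mat"
  assumes carrier: "\<And>x. A x \<in> carrier_mat n n" "B \<in> carrier_mat n n"
    and lim: "\<And>i j. i < n \<Longrightarrow> j < n \<Longrightarrow> ((\<lambda>x. index_mat (A x) (i, j)) \<longlongrightarrow> index_mat B (i, j)) F"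
  shows "((\<lambda>x. Determinant.det (A x)) \<longlongrightarrow> Determinant.det B) F"
  unfolding det_def'[OF carrier(1)] det_def'[OF carrier(2)]
proof (intro tendsto_sum tendsto_mult tendsto_const tendsto_prod)
  fix p i assume "p \<in> {p. p permutes {0..<n}}" "i \<in> {0..<n}"
  then show "((\<lambda>x. index_mat (A x) (i, p i)) \<longlongrightarrow> index_mat B (i, p i)) F"
    by (intro lim) (auto simp: permutes_in_image dest: permutes_in_image[of _ _ i])
qed

lemma tendsto_adj_mat:
  fixes A :: "'x \<Rightarrow> complex Matrix.mat"
  assumes carrier: "\<And>x. A x \<in> carrier_mat n n" "B \<in> carrier_mat n n"
    and lim: "\<And>i j. i < n \<Longrightarrow> j < n \<Longrightarrow> ((\<lambda>x. index_mat (A x) (i, j)) \<longlongrightarrow> index_mat B (i, j)) F"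
    and ij: "i < n" "j < n"
  shows "((\<lambda>x. index_mat (adj_mat (A x)) (i, j)) \<longlongrightarrow> index_mat (adj_mat B) (i, j)) F"
proof -
  have dim: "dim_row (A x) = n" "dim_col (A x) = n" "dim_row B = n" "dim_col B = n" for x
    using carrier by auto
  have "((\<lambda>x. Determinant.det (mat_delete (A x) j i)) \<longlongrightarrow> Determinant.det (mat_delete B j i)) F"
  proof (rule tendsto_det)
    fix k l assume "k < n - 1" "l < n - 1"
    then show "((\<lambda>x. index_mat (mat_delete (A x) j i) (k, l)) \<longlongrightarrow> index_mat (mat_delete B j i) (k, l)) F"
      by (auto simp: mat_delete_def dim intro!: lim)
  qed (rule mat_delete_carrier, rule carrier)+
  then show ?thesis
    using ij by (auto simp: adj_mat_def dim cofactor_def intro!: tendsto_mult)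
qed

lemma tendsto_hankel_mat:
  assumes "\<And>v. ((\<lambda>x. fps_nth (E x) v) \<longlongrightarrow> fps_nth A v) F" "i < q" "j < q"
  shows "((\<lambda>x. index_mat (hankel_mat (E x) p q) (i, j)) \<longlongrightarrow> index_mat (hankel_mat A p q) (i, j)) F"
  using assms by (auto simp: hankel_mat_def fps_nth_int_def)

lemma tendsto_hankel_det:
  assumes "\<And>v. ((\<lambda>x. fps_nth (E x) v) \<longlongrightarrow> fps_nth A v) F"
  shows "((\<lambda>x. hankel_det (E x) p q) \<longlongrightarrow> hankel_det A p q) F"
  unfolding hankel_det_def hankel_mat_def[symmetric]
  by (intro tendsto_det[of _ q] tendsto_hankel_mat assms) auto

text \<open>Cramer's formula involves finitely many Taylor coefficients and one division, whose
  divisor tends to the nonzero \<open>hankel_det A p q\<close>.\<close>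

lemma tendsto_coeff_pade_den:
  assumes lim: "\<And>v. ((\<lambda>x. fps_nth (E x) v) \<longlongrightarrow> fps_nth A v) F" and det: "hankel_det A p q \<noteq> 0"
  shows "((\<lambda>x. poly.coeff (pade_den (E x) p q) k) \<longlongrightarrow> poly.coeff (pade_den A p q) k) F"
proof (cases "k = 0 \<or> k > q")
  case False
  then have k: "q - k < q" by auto
  have vec: "vec_index (pade_vec A p q) (q - k) = - 1 / hankel_det A p q *
     (\<Sum>i<q. index_mat (adj_mat (hankel_mat A p q)) (q - k, i) * fps_nth A (p + 1 + i))" for A
    using k adj_mat(1)[OF hankel_mat_carrier[of A p q]]
    by (simp add: pade_vec_def scalar_prod_def atLeast0LessThan)
  have "((\<lambda>x. vec_index (pade_vec (E x) p q) (q - k)) \<longlongrightarrow> vec_index (pade_vec A p q) (q - k)) F"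
    unfolding vec
    by (intro tendsto_intros tendsto_hankel_det lim det tendsto_adj_mat[of _ q] tendsto_hankel_mat) (use k in auto)
  then show ?thesis using False by (simp add: coeff_pade_den)
qed (auto simp: coeff_pade_den)

lemma tendsto_coeff_pade_num:
  assumes lim: "\<And>v. ((\<lambda>x. fps_nth (E x) v) \<longlongrightarrow> fps_nth A v) F" and det: "hankel_det A p q \<noteq> 0"
  shows "((\<lambda>x. poly.coeff (pade_num (E x) p q) k) \<longlongrightarrow> poly.coeff (pade_num A p q) k) F"
proof (cases "k < Suc p")
  case True
  then show ?thesis
    by (auto simp: pade_num_def fps_mult_nth intro!: tendsto_sum tendsto_mult lim tendsto_coeff_pade_den det)
qed (simp add: pade_num_def)

text \<open>A common degree bound leaves finitely many coefficients, and the powers of w are bounded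
  on S.\<close>

lemma uniform_limit_poly:
  fixes P :: "'x \<Rightarrow> complex poly"
  assumes "bounded S" "\<And>x. degree (P x) \<le> n" "degree Q \<le> n"
    and lim: "\<And>k. ((\<lambda>x. poly.coeff (P x) k) \<longlongrightarrow> poly.coeff Q k) F"
  shows "uniform_limit S (\<lambda>x. poly (P x)) (poly Q) F"
proof (rule uniform_limitI)
  fix e :: real assume "e > 0"
  obtain M where M: "\<And>w. w \<in> S \<Longrightarrow> cmod w \<le> M" using assms(1) unfolding bounded_iff by blast
  have poly: "poly R w = (\<Sum>k\<le>n. poly.coeff R k * w ^ k)" if "degree R \<le> n" for R :: "complex poly" and w
    unfolding poly_altdef using that by (intro sum.mono_neutral_left) (auto simp: coeff_eq_0)
  have "((\<lambda>x. \<Sum>k\<le>n. cmod (poly.coeff (P x) k - poly.coeff Q k) * M ^ k)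
      \<longlongrightarrow> (\<Sum>k\<le>n. cmod (poly.coeff Q k - poly.coeff Q k) * M ^ k)) F"
    by (intro tendsto_intros lim)
  then have "eventually (\<lambda>x. (\<Sum>k\<le>n. cmod (poly.coeff (P x) k - poly.coeff Q k) * M ^ k) < e) F"
    by (rule order_tendstoD(2)) (use \<open>e > 0\<close> in simp)
  then show "eventually (\<lambda>x. \<forall>w\<in>S. dist (poly (P x) w) (poly Q w) < e) F"
  proof eventually_elim
    case (elim x)
    show ?case
    proof
      fix w assume w: "w \<in> S"
      have "poly (P x) w - poly Q w = (\<Sum>k\<le>n. (poly.coeff (P x) k - poly.coeff Q k) * w ^ k)"
        using assms(2,3) by (simp add: poly sum_subtractf left_diff_distrib)
      also have "cmod \<dots> \<le> (\<Sum>k\<le>n. cmod (poly.coeff (P x) k - poly.coeff Q k) * M ^ k)"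
        by (intro sum_norm_le) (auto simp: norm_mult norm_power intro!: mult_left_mono power_mono M w)
      finally show "dist (poly (P x) w) (poly Q w) < e" using elim by (simp add: dist_norm)
    qed
  qed
qed

lemma pade_at_eq:
  assumes "f \<in> pade_class p q \<zeta>"
  defines "A \<equiv> fps_expansion f \<zeta>"
  shows "pade_at p q f \<zeta> z = (if poly (pade_den A p q) (z - \<zeta>) = 0 then None
     else Some (poly (pade_num A p q) (z - \<zeta>) / poly (pade_den A p q) (z - \<zeta>)))"
proof -
  have det: "hankel_det A p q \<noteq> 0" using assms by (simp add: pade_class_def)
  have "poly.coeff (pade_den A p q) 0 = 1" by (simp add: coeff_pade_den)
  then have "pade_den A p q \<noteq> 0" by auto
  then show ?thesis
    unfolding pade_at_def A_def[symmetric] pade_eq_Fract[OF det] by (rule fract_eval_Fract[OF coprime_pade[OF det]])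
qed

section \<open>Openness of the approximation conditions\<close>

lemma eventually_nhdsin_hol:
  assumes "f \<in> hol_space \<Omega>" "compact K" "K \<subseteq> \<Omega>" "e > 0"
  shows "eventually (\<lambda>g. g \<in> hol_space \<Omega> \<and> (\<forall>z\<in>K. dist (f z) (g z) < e)) (nhdsin (hol_topology \<Omega>) f)"
  unfolding eventually_nhdsin
proof (intro disjI2 exI conjI)
  show "openin (hol_topology \<Omega>) {g \<in> hol_space \<Omega>. \<forall>z\<in>K. dist (f z) (g z) < e}"
    by (rule openin_hol_basic[OF assms(1-3)])
qed (use assms(1,4) in auto)

text \<open>Cauchy's inequality on a fixed closed disc in \<Omega> bounds each Taylor coefficient of
  g - f by the uniform distance on that disc.\<close>

lemma tendsto_fps_expansion:
  assumes "open \<Omega>" "\<zeta> \<in> \<Omega>" "f \<in> hol_space \<Omega>"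
  shows "((\<lambda>g. fps_nth (fps_expansion g \<zeta>) v) \<longlongrightarrow> fps_nth (fps_expansion f \<zeta>) v) (nhdsin (hol_topology \<Omega>) f)"
proof (rule tendstoI)
  fix e :: real assume "e > 0"
  obtain r where r: "r > 0" "cball \<zeta> r \<subseteq> \<Omega>" using assms(1,2) open_contains_cball by blast
  \<comment> \<open>Makes the bound B / r^v for the coefficient equal to e / 2.\<close>
  define B where "B = e * r ^ v / 2"
  have B: "B > 0" using \<open>e > 0\<close> r(1) by (simp add: B_def)
  show "eventually (\<lambda>g. dist (fps_nth (fps_expansion g \<zeta>) v) (fps_nth (fps_expansion f \<zeta>) v) < e) (nhdsin (hol_topology \<Omega>) f)"
    using eventually_nhdsin_hol[OF assms(3) compact_cball r(2) B]
  proof eventually_elim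
    case (elim g)
    have hol: "f holomorphic_on \<Omega>" "g holomorphic_on \<Omega>" using elim assms(3) by (auto simp: hol_space_def)
    then have hol_diff: "(\<lambda>w. g w - f w) holomorphic_on cball \<zeta> r"
      using r(2) by (intro holomorphic_intros) (auto intro: holomorphic_on_subset)
    have "cmod ((deriv ^^ v) (\<lambda>w. g w - f w) \<zeta>) \<le> fact v * B / r ^ v"
    proof (rule Cauchy_inequality)
      show "(\<lambda>w. g w - f w) holomorphic_on ball \<zeta> r"
        using hol_diff ball_subset_cball by (rule holomorphic_on_subset)
      show "continuous_on (cball \<zeta> r) (\<lambda>w. g w - f w)" using hol_diff by (rule holomorphic_on_imp_continuous_on)
      fix x assume "cmod (\<zeta> - x) = r"
      then have "dist (f x) (g x) < B" using elim by (simp add: dist_norm)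
      then show "cmod (g x - f x) \<le> B" by (simp add: dist_norm norm_minus_commute)
    qed (rule r(1))
    also have "fact v * B / r ^ v < fact v * e" using r(1) \<open>e > 0\<close> by (simp add: B_def)
    also have "(deriv ^^ v) (\<lambda>w. g w - f w) \<zeta> = (deriv ^^ v) g \<zeta> - (deriv ^^ v) f \<zeta>"
      by (rule higher_deriv_diff[OF hol(2,1) assms(1,2)])
    finally have "cmod ((deriv ^^ v) g \<zeta> - (deriv ^^ v) f \<zeta>) < fact v * e" .
    moreover have "cmod (((deriv ^^ v) g \<zeta> - (deriv ^^ v) f \<zeta>) / fact v) = cmod ((deriv ^^ v) g \<zeta> - (deriv ^^ v) f \<zeta>) / fact v"
      by (simp add: norm_divide)
    ultimately show ?case
      by (simp add: fps_expansion_def dist_norm diff_divide_distrib[symmetric] divide_less_eq mult.commute)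
  qed
qed

text \<open>A supremum below c is finite, so the denominator has no zero on K and, by compactness,
  stays away from 0 there. Uniform convergence of numerator and denominator then passes to the
  quotient.\<close>

lemma openin_pade_close:
  assumes "open \<Omega>" "\<zeta> \<in> \<Omega>" "compact K" "K \<subseteq> \<Omega>"
  shows "openin (hol_topology \<Omega>) {f \<in> hol_space \<Omega>. f \<in> pade_class p q \<zeta> \<and>
     (SUP z\<in>K. ext_dist (pade_at p q f \<zeta> z) (f z)) < ennreal c}" (is "openin _ ?V")
proof (rule openin_subopen[THEN iffD2], rule ballI)
  fix f assume "f \<in> ?V"
  then have f: "f \<in> hol_space \<Omega>" "f \<in> pade_class p q \<zeta>"
    and sup: "(SUP z\<in>K. ext_dist (pade_at p q f \<zeta> z) (f z)) < ennreal c" by auto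
  let ?F = "nhdsin (hol_topology \<Omega>) f"
  define A where "A = fps_expansion f \<zeta>"
  define N D where "N = (\<lambda>g. poly (pade_num (fps_expansion g \<zeta>) p q))"
    and "D = (\<lambda>g. poly (pade_den (fps_expansion g \<zeta>) p q))"
  have det: "hankel_det A p q \<noteq> 0" using f(2) by (simp add: A_def pade_class_def)
  have lim: "((\<lambda>g. fps_nth (fps_expansion g \<zeta>) v) \<longlongrightarrow> fps_nth A v) ?F" for v
    unfolding A_def by (rule tendsto_fps_expansion[OF assms(1,2) f(1)])
  define S where "S = (\<lambda>z. z - \<zeta>) ` K"
  have S: "compact S" unfolding S_def by (intro compact_continuous_image continuous_intros assms(3))
  define r where "r = enn2real (SUP z\<in>K. ext_dist (pade_at p q f \<zeta> z) (f z))"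
  have c0: "c > 0" using sup by (metis ennreal_less_zero_iff not_less_zero zero_less_iff_neq_zero)
  have sup_fin: "(SUP z\<in>K. ext_dist (pade_at p q f \<zeta> z) (f z)) = ennreal r"
    unfolding r_def using ennreal_enn2real[OF less_trans[OF sup ennreal_less_top]] by (rule sym)
  have r0: "0 \<le> r" unfolding r_def by (rule enn2real_nonneg)
  then have r: "0 \<le> r" "r < c" using sup unfolding sup_fin by (simp_all add: ennreal_less_iff)
  have D_nz: "D f (z - \<zeta>) \<noteq> 0" and close: "cmod (N f (z - \<zeta>) / D f (z - \<zeta>) - f z) \<le> r" if z: "z \<in> K" for z
  proof -
    have le: "ext_dist (pade_at p q f \<zeta> z) (f z) \<le> ennreal r"
      unfolding sup_fin[symmetric] by (rule SUP_upper[OF z])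
    show "D f (z - \<zeta>) \<noteq> 0"
      using le by (auto simp: pade_at_eq[OF f(2)] D_def ext_dist_def top_unique)
    then show "cmod (N f (z - \<zeta>) / D f (z - \<zeta>) - f z) \<le> r"
      using le r by (simp add: pade_at_eq[OF f(2)] D_def N_def ext_dist_def)
  qed
  have contN: "continuous_on S (N f)" and contD: "continuous_on S (D f)"
    unfolding N_def D_def by (intro continuous_intros)+
  obtain b where b: "b > 0" "\<And>w. w \<in> S \<Longrightarrow> b \<le> cmod (D f w)"
  proof (cases "S = {}")
    case False
    obtain w0 where "w0 \<in> S" "\<And>w. w \<in> S \<Longrightarrow> cmod (D f w0) \<le> cmod (D f w)"
      using continuous_attains_inf[OF S False continuous_on_norm[OF contD]] by blast
    then show ?thesis using D_nz by (intro that[of "cmod (D f w0)"]) (auto simp: S_def)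
  qed (use that[of 1] in auto)
  have limN: "uniform_limit S N (N f) ?F" unfolding N_def
    by (rule uniform_limit_poly[OF compact_imp_bounded[OF S] degree_pade_num degree_pade_num
          tendsto_coeff_pade_num[OF lim det, unfolded A_def]])
  have limD: "uniform_limit S D (D f) ?F" unfolding D_def
    by (rule uniform_limit_poly[OF compact_imp_bounded[OF S] degree_pade_den degree_pade_den
          tendsto_coeff_pade_den[OF lim det, unfolded A_def]])
  have limR: "uniform_limit S (\<lambda>g w. N g w / D g w) (\<lambda>w. N f w / D f w) ?F"
    by (rule uniform_lim_divide[OF limN limD _ b(2,1)]) (use compact_imp_bounded compact_continuous_image contN S in blast)
  \<comment> \<open>Passing from f to g costs e for the approximant and e for the function. The
    supremum inherits only a non-strict bound, so r + 2 e has to stay strictly below c.\<close>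
  define e where "e = (c - r) / 3"
  have e: "e > 0" "r + e + e < c" using r by (simp_all add: e_def field_simps)
  have "eventually (\<lambda>g. g \<in> ?V) ?F"
    using tendsto_imp_eventually_ne[OF tendsto_hankel_det[OF lim] det]
      uniform_limitD[OF limR e(1)] uniform_limitD[OF limD b(1)] eventually_nhdsin_hol[OF f(1) assms(3,4) e(1)]
  proof eventually_elim
    case (elim g)
    then have g: "g \<in> pade_class p q \<zeta>" by (simp add: pade_class_def)
    have "ext_dist (pade_at p q g \<zeta> z) (g z) \<le> ennreal (r + e + e)" if z: "z \<in> K" for z
    proof -
      have w: "z - \<zeta> \<in> S" using z by (simp add: S_def)
      \<comment> \<open>The value of \<open>D f\<close> has modulus at least b, so nothing at
        distance less than b from it is 0.\<close>
      have "dist (D g (z - \<zeta>)) (D f (z - \<zeta>)) < b" using elim w by blast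
      then have nz: "D g (z - \<zeta>) \<noteq> 0" using b(2)[OF w] by (auto simp: dist_norm)
      have "dist (N g (z - \<zeta>) / D g (z - \<zeta>)) (g z) \<le> dist (N g (z - \<zeta>) / D g (z - \<zeta>)) (N f (z - \<zeta>) / D f (z - \<zeta>))
         + dist (N f (z - \<zeta>) / D f (z - \<zeta>)) (f z) + dist (f z) (g z)"
        by (rule order_trans[OF dist_triangle[of _ _ "f z"]]) (simp add: dist_triangle)
      also have "\<dots> \<le> e + r + e"
        using elim w z close[OF z] by (intro add_mono) (auto simp: dist_norm less_imp_le)
      finally show ?thesis
        using nz by (simp add: pade_at_eq[OF g] D_def N_def ext_dist_def dist_norm ennreal_leI add_ac)
    qed
    then have "(SUP z\<in>K. ext_dist (pade_at p q g \<zeta> z) (g z)) \<le> ennreal (r + e + e)" by (rule SUP_least)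
    also have "\<dots> < ennreal c" using e c0 by (simp add: ennreal_lessI)
    finally show ?case using elim g by simp
  qed
  then show "\<exists>T. openin (hol_topology \<Omega>) T \<and> f \<in> T \<and> T \<subseteq> ?V"
    unfolding eventually_nhdsin using f(1) by auto
qed

section \<open>Density and conclusion\<close>

text \<open>If coprimality fails, the two polynomials share a root \<beta>, nonzero because B(0) is
  nonzero. The equation A(\<beta>) + c \<beta>^p = 0 then determines c, and B has finitely many
  roots.\<close>

lemma coprime_add_monom:
  fixes A B :: "complex poly"
  assumes "poly B 0 \<noteq> 0"
  shows "finite {c. \<not> coprime (A + monom c p) B}"
proof (rule finite_subset)
  have "B \<noteq> 0" using assms by auto
  then show "finite ((\<lambda>\<beta>. - poly A \<beta> / \<beta> ^ p) ` {\<beta>. poly B \<beta> = 0})"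
    by (intro finite_imageI poly_roots_finite)
  show "{c. \<not> coprime (A + monom c p) B} \<subseteq> (\<lambda>\<beta>. - poly A \<beta> / \<beta> ^ p) ` {\<beta>. poly B \<beta> = 0}"
  proof
    fix c assume "c \<in> {c. \<not> coprime (A + monom c p) B}"
    then obtain g where g: "g dvd A + monom c p" "g dvd B" "\<not> is_unit g" unfolding coprime_def by blast
    have "g \<noteq> 0" using g(2) \<open>B \<noteq> 0\<close> by auto
    then have "degree g \<noteq> 0" using g(3) is_unit_iff_degree by blast
    then have "\<not> constant (poly g)" by (simp add: constant_degree)
    then obtain \<beta> where "poly g \<beta> = 0" using fundamental_theorem_of_algebra by blast
    then have "poly h \<beta> = 0" if "g dvd h" for h using that by (auto elim!: dvdE)
    with g have \<beta>: "poly (A + monom c p) \<beta> = 0" "poly B \<beta> = 0" by blast+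
    then have "\<beta> \<noteq> 0" using assms by auto
    then have "c = - poly A \<beta> / \<beta> ^ p"
      using \<beta>(1) by (simp add: poly_monom field_simps eq_neg_iff_add_eq_0 add.commute)
    with \<beta>(2) show "c \<in> (\<lambda>\<beta>. - poly A \<beta> / \<beta> ^ p) ` {\<beta>. poly B \<beta> = 0}" by blast
  qed
qed

lemma fps_expansion_rational:
  assumes "open \<Omega>" "\<zeta> \<in> \<Omega>" "g analytic_on {\<zeta>}" "poly B 0 \<noteq> (0 :: complex)"
    and g: "\<And>z. z \<in> \<Omega> \<Longrightarrow> g z = poly A (z - \<zeta>) / poly B (z - \<zeta>)"
  shows "fps_expansion g \<zeta> = fps_of_poly A / fps_of_poly B"
proof -
  have poly: "poly P has_fps_expansion fps_of_poly P" for P :: "complex poly"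
    using eval_fps_has_fps_expansion[of "fps_of_poly P"] by (simp add: eval_fps_of_poly[abs_def])
  have "open ((\<lambda>w. \<zeta> + w) -` \<Omega>)"
    using assms(1) by (intro continuous_open_vimage) (auto intro: continuous_intros)
  then have "eventually (\<lambda>w. w \<in> (\<lambda>w. \<zeta> + w) -` \<Omega>) (nhds 0)"
    using assms(2) by (intro eventually_nhds_in_open) auto
  then have "eventually (\<lambda>w. g (\<zeta> + w) = poly A w / poly B w) (nhds 0)"
    by eventually_elim (simp add: g)
  moreover have "(\<lambda>w. poly A w / poly B w) has_fps_expansion fps_of_poly A / fps_of_poly B"
    using assms(4) by (intro has_fps_expansion_divide' poly) (simp add: poly_0_coeff_0)
  ultimately have "(\<lambda>w. g (\<zeta> + w)) has_fps_expansion fps_of_poly A / fps_of_poly B"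
    using has_fps_expansion_cong by fast
  then show ?thesis
    using fps_expansion_unique_complex[OF analytic_at_imp_has_fps_expansion[OF assms(3)]] by blast
qed

text \<open>
  A rational function with numerator of degree exactly \<open>p\<close> is its own approximant. The exact degree
  is what makes the Hankel determinant nonzero.
\<close>

lemma rational_pade:
  assumes "open \<Omega>" "\<zeta> \<in> \<Omega>" "g holomorphic_on \<Omega>" "\<And>z. z \<in> \<Omega> \<Longrightarrow> poly B (z - \<zeta>) \<noteq> 0"
    and g: "\<And>z. z \<in> \<Omega> \<Longrightarrow> g z = poly A (z - \<zeta>) / poly B (z - \<zeta>)"
    and AB: "coprime A B" "poly B 0 = 1" "A \<noteq> 0" "degree A = p" "degree B \<le> q"
  shows "g \<in> pade_class p q \<zeta>" "z \<in> \<Omega> \<Longrightarrow> pade_at p q g \<zeta> z = Some (g z)"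
proof -
  have exp: "fps_expansion g \<zeta> = fps_of_poly A / fps_of_poly B"
    using assms by (intro fps_expansion_rational) (auto simp: analytic_at)
  have B0: "poly.coeff B 0 = 1" using AB(2) by (simp add: poly_0_coeff_0)
  show "g \<in> pade_class p q \<zeta>"
    using hankel_det_rational_nonzero[OF AB(1) B0 AB(3-5)] by (simp add: pade_class_def exp)
  have "is_pade (fps_of_poly A / fps_of_poly B) p q (Fraction_Field.Fract A B)"
    using AB B0 unfolding is_pade_def by blast
  then have "pade (fps_expansion g \<zeta>) p q = Fraction_Field.Fract A B" unfolding exp by (rule pade_eqI)
  moreover have "B \<noteq> 0" using AB(2) by auto
  ultimately show "pade_at p q g \<zeta> z = Some (g z)" if "z \<in> \<Omega>"
    using fract_eval_Fract[OF AB(1)] assms(4)[OF that] g[OF that] by (simp add: pade_at_def)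
qed

lemma rational_pade_dense:
  assumes "open \<Omega>" "\<zeta> \<in> \<Omega>" and F: "\<And>m. \<exists>p q. (p, q) \<in> F \<and> m \<le> p \<and> m \<le> q"
    and f: "f \<in> hol_space \<Omega>" and K: "compact K" "K \<subseteq> \<Omega>" and "e > 0"
  obtains g p q where "g \<in> hol_space \<Omega>" "\<And>z. z \<in> K \<Longrightarrow> dist (f z) (g z) < e" "(p, q) \<in> F"
    "g \<in> pade_class p q \<zeta>" "\<And>z. z \<in> \<Omega> \<Longrightarrow> pade_at p q g \<zeta> z = Some (g z)"
proof -
  obtain n where n: "K \<subseteq> exhaustion \<Omega> n" using compact_subset_exhaustion[OF assms(1) K] by blast
  have "rational_limit \<Omega> (exhaustion \<Omega> n) f"
    using Runge_exhaustion[OF assms(1)] f by (simp add: hol_space_def)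
  then obtain A0 B0 where AB0: "\<forall>z\<in>\<Omega>. poly B0 z \<noteq> 0"
    "\<forall>z\<in>exhaustion \<Omega> n. cmod (f z - poly A0 z / poly B0 z) < e / 2"
    using half_gt_zero[OF \<open>e > 0\<close>] unfolding rational_limit_def by blast
  \<comment> \<open>Dividing both polynomials by this value gives the denominator the value 1 at the
    origin of the local variable.\<close>
  define b where "b = poly B0 \<zeta>"
  have b: "b \<noteq> 0" using AB0(1) assms(2) by (simp add: b_def)
  define A B where "A = Polynomial.smult (1 / b) (pcompose A0 [:\<zeta>, 1:])"
    and "B = Polynomial.smult (1 / b) (pcompose B0 [:\<zeta>, 1:])"
  have poly_AB: "poly A (z - \<zeta>) = poly A0 z / b" "poly B (z - \<zeta>) = poly B0 z / b" for z
    by (simp_all add: A_def B_def poly_pcompose)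
  have B_nz: "poly B (z - \<zeta>) \<noteq> 0" if "z \<in> \<Omega>" for z using AB0(1) b that by (simp add: poly_AB)
  have B_0: "poly B 0 = 1" using poly_AB(2)[of \<zeta>] b by (simp add: b_def)
  \<comment> \<open>The successor makes p strictly larger than deg A, so the added monomial becomes
    the leading term.\<close>
  obtain p q where "(p, q) \<in> F" "Suc (degree A + degree B) \<le> p" "Suc (degree A + degree B) \<le> q"
    using F by blast
  then have pq: "(p, q) \<in> F" "degree A < p" "degree B \<le> q" by auto
  have "continuous_on K (\<lambda>z. (z - \<zeta>) ^ p / poly B (z - \<zeta>))"
    using B_nz K(2) by (intro continuous_intros) auto
  then have "bounded ((\<lambda>z. (z - \<zeta>) ^ p / poly B (z - \<zeta>)) ` K)"
    using K(1) compact_continuous_image compact_imp_bounded by blast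
  then obtain M where M: "M > 0" "\<And>z. z \<in> K \<Longrightarrow> cmod ((z - \<zeta>) ^ p / poly B (z - \<zeta>)) \<le> M"
    unfolding bounded_pos by auto
  \<comment> \<open>Within this radius the perturbation stays below e / 2 on K, and an infinite disc
    contains a nonzero c outside the finite exceptional set.\<close>
  have "infinite (ball (0 :: complex) (e / (2 * M)))"
    using uncountable_ball[of "e / (2 * M)" "0 :: complex"] \<open>e > 0\<close> M(1) countable_finite by fastforce
  moreover have "finite (insert 0 {c. \<not> coprime (A + monom c p) B})" using coprime_add_monom B_0 by simp
  ultimately have "infinite (ball 0 (e / (2 * M)) - insert 0 {c. \<not> coprime (A + monom c p) B})"
    by (rule Diff_infinite_finite[rotated])
  then obtain c where "c \<in> ball 0 (e / (2 * M)) - insert 0 {c. \<not> coprime (A + monom c p) B}"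
    using infinite_imp_nonempty by blast
  then have c: "c \<in> ball 0 (e / (2 * M))" "c \<noteq> 0" "coprime (A + monom c p) B" by auto
  define P where "P = A + monom c p"
  have degP: "degree P = p" using pq(2) c(2) by (simp add: P_def degree_add_eq_right degree_monom_eq)
  then have "P \<noteq> 0" using pq(2) by auto
  define g where "g = restrict (\<lambda>z. poly P (z - \<zeta>) / poly B (z - \<zeta>)) \<Omega>"
  have "(\<lambda>z. poly P (z - \<zeta>) / poly B (z - \<zeta>)) holomorphic_on \<Omega>"
    using B_nz by (intro holomorphic_intros) auto
  then have g_hol: "g holomorphic_on \<Omega>"
    by (rule holomorphic_transform) (simp add: g_def)
  have g_eq: "g z = poly P (z - \<zeta>) / poly B (z - \<zeta>)" if "z \<in> \<Omega>" for z using that by (simp add: g_def)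
  have "dist (f z) (g z) < e" if z: "z \<in> K" for z
  proof -
    have "cmod (c * ((z - \<zeta>) ^ p / poly B (z - \<zeta>))) \<le> cmod c * M"
      unfolding norm_mult by (intro mult_left_mono M z) simp
    also have "\<dots> < e / 2" using c(1) M(1) by (simp add: field_simps)
    finally have small: "cmod (c * ((z - \<zeta>) ^ p / poly B (z - \<zeta>))) < e / 2" .
    have "poly A0 z / poly B0 z = poly A (z - \<zeta>) / poly B (z - \<zeta>)" using b by (simp add: poly_AB)
    then have "f z - g z = (f z - poly A0 z / poly B0 z) - c * ((z - \<zeta>) ^ p / poly B (z - \<zeta>))"
      using z K(2) by (subst g_eq) (auto simp: P_def poly_monom add_divide_distrib)
    also have "cmod \<dots> < e"
      using small AB0(2) z n norm_triangle_ineq4[of "f z - poly A0 z / poly B0 z" "c * ((z - \<zeta>) ^ p / poly B (z - \<zeta>))"]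
      by fastforce
    finally show ?thesis by (simp add: dist_norm)
  qed
  moreover have "g \<in> hol_space \<Omega>" using g_hol by (simp add: hol_space_def g_def)
  ultimately show ?thesis
    using that pq(1) rational_pade[OF assms(1,2) g_hol B_nz g_eq c(3)[folded P_def] B_0 \<open>P \<noteq> 0\<close> degP pq(3)] by blast
qed

text \<open>Every compact subset of \<Omega> lies in all exhaustion sets from some index on, so one
  pair chosen for each n gives a single sequence that serves all K. The property thereby becomes a
  countable intersection of conditions.\<close>

lemma pade_approximable_iff:
  assumes "open \<Omega>"
  shows "pade_approximable \<Omega> \<zeta> F f \<longleftrightarrow> (\<forall>n. \<exists>(p, q)\<in>F. f \<in> pade_class p q \<zeta> \<and>
     (SUP z\<in>exhaustion \<Omega> n. ext_dist (pade_at p q f \<zeta> z) (f z)) < ennreal (1 / real (Suc n)))"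
proof
  assume "pade_approximable \<Omega> \<zeta> F f"
  then obtain p q where pq: "\<forall>n. (p n, q n) \<in> F" "\<forall>n. f \<in> pade_class (p n) (q n) \<zeta>"
    and lim: "\<forall>K. compact K \<and> K \<subseteq> \<Omega> \<longrightarrow> (\<lambda>n. SUP z\<in>K. ext_dist (pade_at (p n) (q n) f \<zeta> z) (f z)) \<longlonglongrightarrow> 0"
    unfolding pade_approximable_def by (elim exE conjE) (rule that)
  show "\<forall>n. \<exists>(p, q)\<in>F. f \<in> pade_class p q \<zeta> \<and>
     (SUP z\<in>exhaustion \<Omega> n. ext_dist (pade_at p q f \<zeta> z) (f z)) < ennreal (1 / real (Suc n))"
  proof
    fix n
    have "eventually (\<lambda>m. (SUP z\<in>exhaustion \<Omega> n. ext_dist (pade_at (p m) (q m) f \<zeta> z) (f z)) < ennreal (1 / real (Suc n))) sequentially"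
      by (rule order_tendstoD(2)[OF lim[rule_format, OF conjI[OF compact_exhaustion exhaustion_subset]]]) simp
    then obtain m where "(SUP z\<in>exhaustion \<Omega> n. ext_dist (pade_at (p m) (q m) f \<zeta> z) (f z)) < ennreal (1 / real (Suc n))"
      using eventually_happens'[OF sequentially_bot] by blast
    then show "\<exists>(p, q)\<in>F. f \<in> pade_class p q \<zeta> \<and>
     (SUP z\<in>exhaustion \<Omega> n. ext_dist (pade_at p q f \<zeta> z) (f z)) < ennreal (1 / real (Suc n))"
      using pq by (intro bexI[of _ "(p m, q m)"]) auto
  qed
next
  assume "\<forall>n. \<exists>(p, q)\<in>F. f \<in> pade_class p q \<zeta> \<and>
     (SUP z\<in>exhaustion \<Omega> n. ext_dist (pade_at p q f \<zeta> z) (f z)) < ennreal (1 / real (Suc n))"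
  then have "\<forall>n. \<exists>pq. pq \<in> F \<and> f \<in> pade_class (fst pq) (snd pq) \<zeta> \<and>
     (SUP z\<in>exhaustion \<Omega> n. ext_dist (pade_at (fst pq) (snd pq) f \<zeta> z) (f z)) < ennreal (1 / real (Suc n))"
    by (force simp: Bex_def)
  then obtain r where r: "\<And>n. r n \<in> F" "\<And>n. f \<in> pade_class (fst (r n)) (snd (r n)) \<zeta>"
    "\<And>n. (SUP z\<in>exhaustion \<Omega> n. ext_dist (pade_at (fst (r n)) (snd (r n)) f \<zeta> z) (f z)) < ennreal (1 / real (Suc n))"
    by metis
  have "(\<lambda>n. SUP z\<in>K. ext_dist (pade_at (fst (r n)) (snd (r n)) f \<zeta> z) (f z)) \<longlonglongrightarrow> 0"
    if K: "compact K" "K \<subseteq> \<Omega>" for K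
  proof -
    obtain j where j: "K \<subseteq> exhaustion \<Omega> j" using compact_subset_exhaustion[OF assms K] by blast
    have inv: "(\<lambda>n. ennreal (1 / real (Suc n))) \<longlonglongrightarrow> ennreal 0"
      using LIMSEQ_Suc[OF lim_1_over_n] by (intro tendsto_ennrealI) simp
    show ?thesis
    proof (rule tendsto_sandwich[OF _ _ tendsto_const inv[unfolded ennreal_0]])
      show "eventually (\<lambda>n. (SUP z\<in>K. ext_dist (pade_at (fst (r n)) (snd (r n)) f \<zeta> z) (f z)) \<le> ennreal (1 / real (Suc n))) sequentially"
        using eventually_ge_at_top[of j]
      proof eventually_elim
        case (elim n)
        then have "K \<subseteq> exhaustion \<Omega> n" using j exhaustion_mono by blast
        then have "(SUP z\<in>K. ext_dist (pade_at (fst (r n)) (snd (r n)) f \<zeta> z) (f z))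
           \<le> (SUP z\<in>exhaustion \<Omega> n. ext_dist (pade_at (fst (r n)) (snd (r n)) f \<zeta> z) (f z))"
          by (rule SUP_subset_mono) simp
        also have "\<dots> \<le> ennreal (1 / real (Suc n))" using r(3) by (rule less_imp_le)
        finally show ?case .
      qed
    qed simp
  qed
  with r(1,2) show "pade_approximable \<Omega> \<zeta> F f"
    unfolding pade_approximable_def by (intro exI[of _ "\<lambda>n. fst (r n)"] exI[of _ "\<lambda>n. snd (r n)"]) simp
qed

theorem theorem5p5:
  fixes \<Omega> :: "complex set" and \<zeta>\<^sub>0 :: complex and F :: "(nat \<times> nat) set"
  assumes "open \<Omega>" and "\<zeta>\<^sub>0 \<in> \<Omega>"
    and "\<exists>p q :: nat \<Rightarrow> nat. (\<forall>n. (p n, q n) \<in> F) \<and>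
           filterlim p at_top sequentially \<and> filterlim q at_top sequentially"
  shows "(\<exists>f \<in> hol_space \<Omega>. pade_approximable \<Omega> \<zeta>\<^sub>0 F f) \<and>
         gdelta_in (hol_topology \<Omega>) {f \<in> hol_space \<Omega>. pade_approximable \<Omega> \<zeta>\<^sub>0 F f} \<and>
         hol_topology \<Omega> closure_of {f \<in> hol_space \<Omega>. pade_approximable \<Omega> \<zeta>\<^sub>0 F f} =
           topspace (hol_topology \<Omega>)"
proof -
  define V where "V = (\<lambda>n. \<Union>(p, q)\<in>F. {f \<in> hol_space \<Omega>. f \<in> pade_class p q \<zeta>\<^sub>0 \<and>
     (SUP z\<in>exhaustion \<Omega> n. ext_dist (pade_at p q f \<zeta>\<^sub>0 z) (f z)) < ennreal (1 / real (Suc n))})"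
  let ?G = "{f \<in> hol_space \<Omega>. pade_approximable \<Omega> \<zeta>\<^sub>0 F f}"
  have G: "?G = (\<Inter>n. V n)"
    by (auto simp: V_def pade_approximable_iff[OF assms(1)])
  have V_open: "openin (hol_topology \<Omega>) (V n)" for n
    unfolding V_def using openin_pade_close[OF assms(1,2) compact_exhaustion exhaustion_subset]
    by (intro openin_Union) auto
  obtain p q where pq: "\<And>n. (p n, q n) \<in> F" "filterlim p at_top sequentially" "filterlim q at_top sequentially"
    using assms(3) by blast
  have large: "\<exists>p q. (p, q) \<in> F \<and> m \<le> p \<and> m \<le> q" for m
  proof -
    have "eventually (\<lambda>n. m \<le> p n \<and> m \<le> q n) sequentially"
      using pq(2,3) by (auto simp: filterlim_at_top intro: eventually_conj)
    then obtain n where "m \<le> p n \<and> m \<le> q n" using eventually_happens'[OF sequentially_bot] by blast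
    with pq(1) show ?thesis by blast
  qed
  have V_dense: "hol_topology \<Omega> closure_of V n = hol_space \<Omega>" for n
  proof (subst hol_dense_iff)
    show "V n \<subseteq> hol_space \<Omega>" by (auto simp: V_def)
    show "\<forall>f\<in>hol_space \<Omega>. \<forall>K e. compact K \<longrightarrow> K \<subseteq> \<Omega> \<longrightarrow> e > 0 \<longrightarrow> (\<exists>g\<in>V n. \<forall>z\<in>K. dist (f z) (g z) < e)"
    proof (intro ballI allI impI)
      fix f K and e :: real assume "f \<in> hol_space \<Omega>" "compact K" "K \<subseteq> \<Omega>" "e > 0"
      then obtain g p q where g: "g \<in> hol_space \<Omega>" "\<And>z. z \<in> K \<Longrightarrow> dist (f z) (g z) < e" "(p, q) \<in> F"
        "g \<in> pade_class p q \<zeta>\<^sub>0" "\<And>z. z \<in> \<Omega> \<Longrightarrow> pade_at p q g \<zeta>\<^sub>0 z = Some (g z)"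
        using rational_pade_dense[OF assms(1,2) large] by metis
      \<comment> \<open>The rational g equals its approximant on \<Omega>, so the error is 0 on
        every exhaustion set.\<close>
      have "(SUP z\<in>exhaustion \<Omega> n. ext_dist (pade_at p q g \<zeta>\<^sub>0 z) (g z)) \<le> 0"
      proof (rule SUP_least)
        fix z assume "z \<in> exhaustion \<Omega> n"
        then have "z \<in> \<Omega>" using exhaustion_subset by blast
        then show "ext_dist (pade_at p q g \<zeta>\<^sub>0 z) (g z) \<le> 0" by (simp add: g(5) ext_dist_def)
      qed
      then have "(SUP z\<in>exhaustion \<Omega> n. ext_dist (pade_at p q g \<zeta>\<^sub>0 z) (g z)) < ennreal (1 / real (Suc n))"
        by (rule le_less_trans) simp
      with g show "\<exists>g\<in>V n. \<forall>z\<in>K. dist (f z) (g z) < e" unfolding V_def by blast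
    qed
  qed
  have dense: "hol_topology \<Omega> closure_of ?G = topspace (hol_topology \<Omega>)"
    unfolding G using hol_topology_Baire[OF assms(1) V_open V_dense] by simp
  moreover have "gdelta_in (hol_topology \<Omega>) ?G"
    unfolding G using V_open by (intro gdelta_in_Inter open_imp_gdelta_in) auto
  \<comment> \<open>Existence follows from density: the empty set is dense only in an empty space,
    and H(\<Omega>) contains the zero function.\<close>
  moreover have "?G \<noteq> {}"
  proof
    assume empty: "?G = {}"
    have "hol_space \<Omega> = {}" using dense unfolding empty by simp
    moreover have "restrict (\<lambda>_. 0) \<Omega> \<in> hol_space \<Omega>"
      by (simp add: hol_space_def) (rule holomorphic_transform[of "\<lambda>_. 0"], auto)
    ultimately show False by blast
  qed
  ultimately show ?thesis by blast
qed

end
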